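(* Let $\mathcal A=\{H_1,\dots,H_m\}$ and $\mathcal B=\{K_1,\dots,K_m\}$ be central hyperplane arrangements in $\mathbb C^d$ with the same underlying matroid, and suppose this matroid is uniform. Then the complement manifolds $M(\mathcal A)$ and $M(\mathcal B)$ are diffeomorphic.
   Context: A central hyperplane arrangement in $\mathbb C^d$ is a finite indexed collection $\mathcal A=\{H_1,\dots,H_m\}$ of linear subspaces of (complex) codimension $1$. Its complement manifold is $M(\mathcal A)=\mathbb C^d\setminus\bigcup_iH_i$. Its underlying matroid is the matroid on $[m]$ with rank function $\operatorname{rk}_{\mathcal A}(I)=\operatorname{codim}\bigcap_{i\in I}H_i$, $I\subseteq[m]$. *)

theory Defs
  imports "HOL-Analysis.Analysis"
begin

text \<open>
  An arrangement of \<open>m\<close> hyperplanes is an indexed family \<open>A\<close>, of which only the members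
  \<open>A 1, \<dots>, A m\<close> matter; repetitions are allowed. Subspaces and dimensions in
  \<open>complex^'d\<close> are over the complex numbers (\<open>vec.subspace\<close>, \<open>vec.dim\<close>);
  the unqualified \<open>subspace\<close> and \<open>dim\<close> would be over the reals.
\<close>

definition codim :: "(complex^'d) set \<Rightarrow> nat" where
  "codim V = CARD('d) - vec.dim V"

definition central_arrangement :: "nat \<Rightarrow> (nat \<Rightarrow> (complex^'d) set) \<Rightarrow> bool" where
  "central_arrangement m A \<longleftrightarrow> (\<forall>i\<in>{1..m}. vec.subspace (A i) \<and> codim (A i) = 1)"

definition complement_manifold :: "nat \<Rightarrow> (nat \<Rightarrow> (complex^'d) set) \<Rightarrow> (complex^'d) set" where
  "complement_manifold m A = UNIV - (\<Union>i\<in>{1..m}. A i)"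

text \<open>
  A matroid is given by its ground set and its rank function. The rank function is made
  \<open>undefined\<close> outside the subsets of the ground set, so that equality of such pairs is
  equality of matroids.
\<close>

type_synonym 'e matroid = "'e set \<times> ('e set \<Rightarrow> nat)"

definition underlying_matroid :: "nat \<Rightarrow> (nat \<Rightarrow> (complex^'d) set) \<Rightarrow> nat matroid" where
  "underlying_matroid m A = ({1..m}, \<lambda>I\<in>Pow {1..m}. codim (\<Inter>i\<in>I. A i))"

definition matroid_indep :: "'e matroid \<Rightarrow> 'e set \<Rightarrow> bool" where
  "matroid_indep M I \<longleftrightarrow> I \<subseteq> fst M \<and> finite I \<and> snd M I = card I"

definition uniform_matroid :: "'e matroid \<Rightarrow> bool" where
  "uniform_matroid M \<longleftrightarrow> (\<exists>r. \<forall>I. I \<subseteq> fst M \<longrightarrow> (matroid_indep M I \<longleftrightarrow> finite I \<and> card I \<le> r))"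

text \<open>
  Real \<open>C\<^sup>k\<close> functions on a set \<open>S\<close>, which is meant to be open in a finite-dimensional
  space: all iterated directional derivatives up to order \<open>k\<close> exist and are continuous.
  The recursion goes through directional derivatives because the type of the \<open>k\<close>-th
  Frechet derivative depends on \<open>k\<close>.
\<close>

primrec Ck_on :: "nat \<Rightarrow> 'a::euclidean_space set \<Rightarrow> ('a \<Rightarrow> 'b::euclidean_space) \<Rightarrow> bool" where
  "Ck_on 0 S f \<longleftrightarrow> continuous_on S f"
| "Ck_on (Suc k) S f \<longleftrightarrow>
     (\<forall>x\<in>S. f differentiable (at x)) \<and> (\<forall>v. Ck_on k S (\<lambda>x. frechet_derivative f (at x) v))"

definition smooth_on :: "'a::euclidean_space set \<Rightarrow> ('a \<Rightarrow> 'b::euclidean_space) \<Rightarrow> bool" where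
  "smooth_on S f \<longleftrightarrow> (\<forall>k. Ck_on k S f)"

text \<open>Diffeomorphic open sets, as open submanifolds of the ambient Euclidean spaces.\<close>

definition diffeomorphic :: "'a::euclidean_space set \<Rightarrow> 'b::euclidean_space set \<Rightarrow> bool" where
  "diffeomorphic S T \<longleftrightarrow> open S \<and> open T \<and>
     (\<exists>f g. smooth_on S f \<and> smooth_on T g \<and> f ` S = T \<and> g ` T = S \<and>
        (\<forall>x\<in>S. g (f x) = x) \<and> (\<forall>y\<in>T. f (g y) = y))"

lemma open_complement_manifold:
  assumes "central_arrangement m A"
  shows "open (complement_manifold m A)"
proof -
  have "closed (A i)" if "i \<in> {1..m}" for i
  proof (rule closed_subspace)
    have V: "vec.subspace (A i)"
      using assms that by (simp add: central_arrangement_def)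
    have eq: "c *\<^sub>R x = complex_of_real c *s x" for c :: real and x :: "complex^'d"
      by (simp add: vec_eq_iff scaleR_conv_of_real[where ?'a = complex])
    show "subspace (A i)"
      unfolding subspace_def eq
      using V by (auto simp: vec.subspace_0 vec.subspace_add vec.subspace_scale)
  qed
  then have "closed (\<Union>i\<in>{1..m}. A i)"
    by (intro closed_UN) auto
  then show ?thesis
    by (simp add: complement_manifold_def open_Diff)
qed

end

theory Submission
  imports Defs
begin

text \<open>
  Let \<open>r\<close> be the rank. After linear changes of coordinates the normals of both arrangements lie in
  the same coordinate subspace of dimension \<open>r\<close>, and any \<open>r\<close> of them are independent. The complex
  line through the two families of normals meets the degenerate families in finitely many points, so
  the remaining parameters are connected and it suffices that nearby parameters have diffeomorphic
  complements.

  For nearby families with linear forms \<open>l i\<close> and \<open>l' i\<close>, every set \<open>t\<close> of \<open>r\<close> indices has a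
  linear map \<open>1 + E t\<close> with \<open>l' i \<circ> (1 + E t) = l i\<close> for \<open>i \<in> t\<close>. Average these with weights proportional to
  \<open>\<Prod>i\<notin>t. \<bar>l i x\<bar>\<^sup>2\<close>. The average \<open>f\<close> differs from the identity by a contraction, since it is
  homogeneous of degree 1 and the \<open>E t\<close> are small; hence it is bijective with smooth inverse. As
  the weight of \<open>t\<close> is \<open>O(\<bar>l i x\<bar> / \<bar>x\<bar>)\<close> for \<open>i \<notin> t\<close>, the difference \<open>l' i (f x) - l i x\<close> is at
  most \<open>\<bar>l i x\<bar> / 2\<close>, so \<open>f\<close> maps complement onto complement.
\<close>

section \<open>Smooth maps and diffeomorphisms\<close>

lemma Ck_on_SucD: "Ck_on (Suc k) S f \<Longrightarrow> Ck_on k S f"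
proof (induction k arbitrary: f)
  case 0
  then show ?case
    by (auto intro!: continuous_at_imp_continuous_on differentiable_imp_continuous_within)
next
  case (Suc k)
  then show ?case by (metis Ck_on.simps(2))
qed

lemma Ck_on_imp_continuous_on: "Ck_on k S f \<Longrightarrow> continuous_on S f"
  by (induction k) (use Ck_on_SucD in \<open>auto simp del: Ck_on.simps(2)\<close>)

text \<open>A product rule in which the second factor need only be continuous: where
  \<open>p\<close> vanishes, the term with the derivative of \<open>q\<close> drops out. It serves
  to differentiate an inverse of which only continuity is known so far.\<close>

lemma has_derivative_scaleR_vanishing:
  fixes q :: "'a::real_normed_vector \<Rightarrow> 'b::real_normed_vector"
  assumes p: "(p has_derivative p') (at x)" "p x = 0" and q: "isCont q x"
  shows "((\<lambda>y. p y *\<^sub>R q y) has_derivative (\<lambda>h. p' h *\<^sub>R q x)) (at x)"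
proof -
  have bl: "bounded_linear p'" using p(1) by (rule has_derivative_bounded_linear)
  obtain K where K: "\<And>h. norm (p' h) \<le> norm h * K" using bl bounded_linear.bounded by blast
  let ?e = "\<lambda>y. norm (p y - p x - p' (y - x)) / norm (y - x)"
  have e: "(?e \<longlongrightarrow> 0) (at x)"
    using p(1) by (simp add: has_derivative_iff_norm)
  have q0: "((\<lambda>y. norm (q y - q x)) \<longlongrightarrow> 0) (at x)"
    using q by (simp add: isCont_def tendsto_norm_zero LIM_zero)
  have "((\<lambda>y. (?e y + K) * norm (q y - q x)) \<longlongrightarrow> (0 + K) * 0) (at x)"
    by (intro tendsto_intros e q0)
  then have lim: "((\<lambda>y. ?e y * norm (q x) + (?e y + K) * norm (q y - q x)) \<longlongrightarrow> 0) (at x)"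
    using tendsto_add[OF tendsto_mult_left_zero[OF e, of "norm (q x)"]] by fastforce
  show ?thesis
    unfolding has_derivative_iff_norm
  proof (intro conjI Lim_null_comparison[OF _ lim])
    show "bounded_linear (\<lambda>h. p' h *\<^sub>R q x)"
      using bl by (rule bounded_linear_scaleR_const)
    show "\<forall>\<^sub>F y in at x. norm (norm (p y *\<^sub>R q y - p x *\<^sub>R q x - p' (y - x) *\<^sub>R q x) / norm (y - x))
      \<le> ?e y * norm (q x) + (?e y + K) * norm (q y - q x)"
    proof (rule eventually_at_topological[THEN iffD2], intro exI[of _ UNIV] conjI ballI impI)
      fix y assume "y \<noteq> x"
      then have n: "norm (y - x) > 0" by simp
      have "p y *\<^sub>R q y - p x *\<^sub>R q x - p' (y - x) *\<^sub>R q x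
        = (p y - p' (y - x)) *\<^sub>R q x + p y *\<^sub>R (q y - q x)"
        by (simp add: p(2) algebra_simps)
      then have "norm (p y *\<^sub>R q y - p x *\<^sub>R q x - p' (y - x) *\<^sub>R q x)
        \<le> \<bar>p y - p' (y - x)\<bar> * norm (q x) + \<bar>p y\<bar> * norm (q y - q x)"
        by (metis norm_scaleR norm_triangle_ineq)
      also have "\<dots> \<le> \<bar>p y - p' (y - x)\<bar> * norm (q x)
          + (\<bar>p y - p' (y - x)\<bar> + norm (y - x) * K) * norm (q y - q x)"
        using K[of "y - x"] by (intro add_left_mono mult_right_mono) auto
      finally have "norm (p y *\<^sub>R q y - p x *\<^sub>R q x - p' (y - x) *\<^sub>R q x) / norm (y - x) \<le>
        (\<bar>p y - p' (y - x)\<bar> * norm (q x)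
          + (\<bar>p y - p' (y - x)\<bar> + norm (y - x) * K) * norm (q y - q x)) / norm (y - x)"
        using n by (intro divide_right_mono) auto
      also have "\<dots> = ?e y * norm (q x) + (?e y + K) * norm (q y - q x)"
        using n p(2) by (simp add: field_simps)
      finally show "norm (norm (p y *\<^sub>R q y - p x *\<^sub>R q x - p' (y - x) *\<^sub>R q x) / norm (y - x))
      \<le> ?e y * norm (q x) + (?e y + K) * norm (q y - q x)" by simp
    qed auto
  qed
qed

text \<open>On an open set, derivatives depend only on the values inside the set, so the induction
  can pass from \<open>f\<close> and \<open>g\<close> to their directional derivatives.\<close>

lemma Ck_on_cong:
  assumes "open S" "\<And>x. x \<in> S \<Longrightarrow> f x = g x" "Ck_on k S f"
  shows "Ck_on k S g"
  using assms(2,3)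
proof (induction k arbitrary: f g)
  case 0
  then show ?case by (auto cong: continuous_on_cong)
next
  case (Suc k)
  have D: "frechet_derivative f (at x) = frechet_derivative g (at x)" "g differentiable at x"
    if "x \<in> S" for x
  proof -
    have "f differentiable at x" using Suc.prems(2) that by simp
    then show "frechet_derivative f (at x) = frechet_derivative g (at x)"
      using Suc.prems(1) that assms(1) by (intro frechet_derivative_transform_within_open)
    show "g differentiable at x"
      using \<open>f differentiable at x\<close>
        has_derivative_transform_within_open[where f = f and g = g, OF _ assms(1) that Suc.prems(1)]
      unfolding differentiable_def by blast
  qed
  have "Ck_on k S (\<lambda>x. frechet_derivative g (at x) v)" for v
    using Suc.IH[of "\<lambda>x. frechet_derivative f (at x) v"] Suc.prems(2) D(1) by simp
  then show ?case using D(2) by simp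
qed

lemma Ck_on_SucI:
  assumes "open S" "\<And>x. x \<in> S \<Longrightarrow> (f has_derivative f' x) (at x)"
    and "\<And>v. Ck_on k S (\<lambda>x. f' x v)"
  shows "Ck_on (Suc k) S f"
proof -
  have "f' x = frechet_derivative f (at x)" if "x \<in> S" for x
    using assms(2)[OF that] by (rule frechet_derivative_at)
  then have "Ck_on k S (\<lambda>x. frechet_derivative f (at x) v)" for v
    using Ck_on_cong[OF assms(1) _ assms(3)[of v]] by simp
  then show ?thesis
    using assms(2) by (auto simp: differentiable_def)
qed

section \<open>Closure properties of functions of class \<open>Ck_on\<close>\<close>

lemma Ck_on_has_derivative:
  "Ck_on (Suc k) S f \<Longrightarrow> x \<in> S \<Longrightarrow> (f has_derivative frechet_derivative f (at x)) (at x)"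
  using frechet_derivative_works by auto

lemma Ck_on_const: "open S \<Longrightarrow> Ck_on k S (\<lambda>x. c)"
  by (induction k arbitrary: c) (auto simp: continuous_on_const frechet_derivative_const)

lemma Ck_on_ident: "open S \<Longrightarrow> Ck_on k S (\<lambda>x. x)"
  by (cases k) (auto intro!: Ck_on_const simp: continuous_on_id frechet_derivative_ident)

lemma Ck_on_add:
  assumes "open S" "Ck_on k S f" "Ck_on k S g"
  shows "Ck_on k S (\<lambda>x. f x + g x)"
  using assms(2,3)
proof (induction k arbitrary: f g)
  case 0
  then show ?case by (auto intro: continuous_on_add)
next
  case (Suc k)
  show ?case
  proof (rule Ck_on_SucI[OF assms(1)])
    fix x assume "x \<in> S"
    then show "((\<lambda>x. f x + g x) has_derivative
        (\<lambda>v. frechet_derivative f (at x) v + frechet_derivative g (at x) v)) (at x)"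
      using Suc.prems by (intro has_derivative_add Ck_on_has_derivative)
  qed (use Suc.prems in \<open>auto intro!: Suc.IH\<close>)
qed

lemma Ck_on_linear:
  assumes "open S" "bounded_linear L" "Ck_on k S f"
  shows "Ck_on k S (\<lambda>x. L (f x))"
  using assms(3)
proof (induction k arbitrary: f)
  case 0
  then show ?case using assms(2) by (auto intro: bounded_linear.continuous_on)
next
  case (Suc k)
  show ?case
  proof (rule Ck_on_SucI[OF assms(1)])
    fix x assume "x \<in> S"
    then show "((\<lambda>x. L (f x)) has_derivative (\<lambda>v. L (frechet_derivative f (at x) v))) (at x)"
      by (rule bounded_linear.has_derivative[OF assms(2) Ck_on_has_derivative[OF Suc.prems]])
  qed (use Suc.prems in \<open>auto intro!: Suc.IH\<close>)
qed

lemma Ck_on_bilinear: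
  assumes "open S" "bounded_bilinear P" "Ck_on k S f" "Ck_on k S g"
  shows "Ck_on k S (\<lambda>x. P (f x) (g x))"
  using assms(3,4)
proof (induction k arbitrary: f g)
  case 0
  then show ?case using assms(2) by (auto intro: bounded_bilinear.continuous_on)
next
  case (Suc k)
  show ?case
  proof (rule Ck_on_SucI[OF assms(1)])
    fix x assume "x \<in> S"
    then show "((\<lambda>x. P (f x) (g x)) has_derivative (\<lambda>v. P (f x) (frechet_derivative g (at x) v)
        + P (frechet_derivative f (at x) v) (g x))) (at x)"
      using Suc.prems assms(2) by (intro bounded_bilinear.FDERIV Ck_on_has_derivative)
  next
    have "Ck_on k S f" "Ck_on k S g"
      using Suc.prems Ck_on_SucD by blast+
    then show "Ck_on k S (\<lambda>x. P (f x) (frechet_derivative g (at x) v)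
        + P (frechet_derivative f (at x) v) (g x))" for v
      using Suc.prems by (intro Ck_on_add[OF assms(1)] Suc.IH) auto
  qed
qed

lemma Ck_on_sum:
  assumes "open S" "\<And>i. i \<in> I \<Longrightarrow> Ck_on k S (f i)"
  shows "Ck_on k S (\<lambda>x. \<Sum>i\<in>I. f i x)"
  using assms(2)
proof (induction I rule: infinite_finite_induct)
  case (insert i I)
  then show ?case using assms(1) by (auto intro!: Ck_on_add)
qed (use assms(1) in \<open>auto intro: Ck_on_const\<close>)

lemma Ck_on_prod:
  fixes f :: "'i \<Rightarrow> 'a::euclidean_space \<Rightarrow> real"
  assumes "open S" "\<And>i. i \<in> I \<Longrightarrow> Ck_on k S (f i)"
  shows "Ck_on k S (\<lambda>x. \<Prod>i\<in>I. f i x)"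
  using assms(2)
proof (induction I rule: infinite_finite_induct)
  case (insert i I)
  then show ?case
    using assms(1) by (auto intro!: Ck_on_bilinear[OF _ bounded_bilinear_mult])
qed (use assms(1) in \<open>auto intro: Ck_on_const\<close>)

lemma Ck_on_inverse:
  fixes f :: "'a::euclidean_space \<Rightarrow> real"
  assumes "open S" "\<And>x. x \<in> S \<Longrightarrow> f x \<noteq> 0" "Ck_on k S f"
  shows "Ck_on k S (\<lambda>x. inverse (f x))"
  using assms(3)
proof (induction k)
  case 0
  then show ?case using assms(2) by (auto intro: continuous_on_inverse)
next
  case (Suc k)
  show ?case
  proof (rule Ck_on_SucI[OF assms(1)])
    fix x assume "x \<in> S"
    then show "((\<lambda>x. inverse (f x)) has_derivative
       (\<lambda>v. - (inverse (f x) * frechet_derivative f (at x) v * inverse (f x)))) (at x)"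
      using Suc.prems assms(2) by (intro Deriv.has_derivative_inverse Ck_on_has_derivative) auto
  next
    show "Ck_on k S (\<lambda>x. - (inverse (f x) * frechet_derivative f (at x) v * inverse (f x)))" for v
      using Suc.prems Suc.IH[OF Ck_on_SucD[OF Suc.prems]] assms(1)
      by (intro Ck_on_linear[OF _ bounded_linear_minus[OF bounded_linear_ident]]
          Ck_on_bilinear[OF _ bounded_bilinear_mult]) auto
  qed
qed

lemma Ck_on_comp:
  fixes f :: "'a::euclidean_space \<Rightarrow> 'b::euclidean_space" and g :: "'b \<Rightarrow> 'c::euclidean_space"
  assumes "open S" "f ` S \<subseteq> T" "Ck_on k S f" "Ck_on k T g"
  shows "Ck_on k S (\<lambda>x. g (f x))"
  using assms(3,4)
proof (induction k arbitrary: g)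
  case 0
  then show ?case by (simp add: continuous_on_compose2[OF _ _ assms(2)])
next
  case (Suc k)
  let ?f' = "\<lambda>x. frechet_derivative f (at x)" and ?g' = "\<lambda>y. frechet_derivative g (at y)"
  \<comment> \<open>In the chain rule the direction \<open>?f' x v\<close> moves with
    \<open>x\<close>, whereas \<open>Ck_on\<close> speaks of fixed directions. Expanding it in the
    basis leaves derivatives of \<open>g\<close> in fixed directions \<open>b\<close> with scalar
    coefficients.\<close>
  have *: "?g' (f x) w = (\<Sum>b\<in>Basis. (w \<bullet> b) *\<^sub>R ?g' (f x) b)" if "x \<in> S" for x w
  proof -
    interpret bounded_linear "?g' (f x)"
      by (rule has_derivative_bounded_linear[OF Ck_on_has_derivative[OF Suc.prems(2)]])
        (use that assms(2) in blast)
    have "?g' (f x) w = ?g' (f x) (\<Sum>b\<in>Basis. (w \<bullet> b) *\<^sub>R b)"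
      by (simp add: euclidean_representation)
    also have "\<dots> = (\<Sum>b\<in>Basis. (w \<bullet> b) *\<^sub>R ?g' (f x) b)"
      by (simp add: sum scaleR)
    finally show ?thesis .
  qed
  show ?case
  proof (rule Ck_on_SucI[OF assms(1)])
    fix x assume x: "x \<in> S"
    have "((g \<circ> f) has_derivative (?g' (f x) \<circ> ?f' x)) (at x)"
      by (rule diff_chain_at[OF Ck_on_has_derivative[OF Suc.prems(1) x]
            Ck_on_has_derivative[OF Suc.prems(2)]]) (use x assms(2) in blast)
    moreover have "?g' (f x) \<circ> ?f' x = (\<lambda>v. \<Sum>b\<in>Basis. (?f' x v \<bullet> b) *\<^sub>R ?g' (f x) b)"
      unfolding o_def by (rule ext, rule *[OF x])
    ultimately show "((\<lambda>x. g (f x)) has_derivative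
        (\<lambda>v. \<Sum>b\<in>Basis. (?f' x v \<bullet> b) *\<^sub>R ?g' (f x) b)) (at x)"
      unfolding o_def by simp
  next
    fix v
    have "Ck_on k S (\<lambda>x. ?g' (f x) b)" for b
      using Suc.prems(2) by (intro Suc.IH Ck_on_SucD[OF Suc.prems(1)]) simp
    moreover have "Ck_on k S (\<lambda>x. ?f' x v \<bullet> b)" for b
      using Suc.prems(1) by (intro Ck_on_linear[OF assms(1) bounded_linear_inner_left]) simp
    ultimately show "Ck_on k S (\<lambda>x. \<Sum>b\<in>Basis. (?f' x v \<bullet> b) *\<^sub>R ?g' (f x) b)"
      by (intro Ck_on_sum Ck_on_bilinear[OF _ bounded_bilinear_scaleR] assms(1))
  qed
qed

section \<open>Diffeomorphism as an equivalence relation on open sets\<close>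

lemma diffeomorphic_refl: "open S \<Longrightarrow> diffeomorphic S S"
  unfolding diffeomorphic_def smooth_on_def
  by (intro conjI exI[of _ "\<lambda>x. x"]) (auto intro: Ck_on_ident)

lemma diffeomorphic_sym: "diffeomorphic S T \<Longrightarrow> diffeomorphic T S"
  unfolding diffeomorphic_def by blast

lemma diffeomorphic_trans:
  assumes "diffeomorphic S T" "diffeomorphic T U"
  shows "diffeomorphic S U"
proof -
  obtain f g where 1: "open S" "open T" "\<And>k. Ck_on k S f" "\<And>k. Ck_on k T g" "f ` S = T" "g ` T = S"
    "\<forall>x\<in>S. g (f x) = x" "\<forall>y\<in>T. f (g y) = y"
    using assms(1) unfolding diffeomorphic_def smooth_on_def by auto
  obtain f' g' where 2: "open U" "\<And>k. Ck_on k T f'" "\<And>k. Ck_on k U g'" "f' ` T = U" "g' ` U = T"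
    "\<forall>x\<in>T. g' (f' x) = x" "\<forall>y\<in>U. f' (g' y) = y"
    using assms(2) unfolding diffeomorphic_def smooth_on_def by auto
  have "Ck_on k S (\<lambda>x. f' (f x))" "Ck_on k U (\<lambda>x. g (g' x))" for k
    using Ck_on_comp[OF \<open>open S\<close>, where f = f and T = T and g = f']
      Ck_on_comp[OF \<open>open U\<close>, where f = g' and T = T and g = g] 1 2 by simp_all
  moreover have "(\<lambda>x. f' (f x)) ` S = U" "(\<lambda>x. g (g' x)) ` U = S"
    using 1(5,6) 2(4,5) by (metis image_image)+
  moreover have "\<forall>x\<in>S. g (g' (f' (f x))) = x" "\<forall>y\<in>U. f' (f (g (g' y))) = y"
    using 1 2 by auto
  ultimately show ?thesis
    unfolding diffeomorphic_def smooth_on_def using 1(1) 2(1) by blast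
qed

section \<open>Smoothness of inverse maps\<close>

text \<open>The resolvent identity expresses the increment of \<open>B\<close> through that of
  \<open>A\<close>. The lower bound on \<open>A\<close> bounds \<open>B\<close> uniformly, which
  yields continuity; the derivative of \<open>B\<close> is then a polynomial in \<open>B\<close> and
  the derivatives of \<open>A\<close>, so each order follows from the one before.\<close>

lemma Ck_on_linear_inverse:
  fixes A :: "'p::euclidean_space \<Rightarrow> 'a::euclidean_space \<Rightarrow> 'a"
  assumes S: "open S"
    and lin: "\<And>y. y \<in> S \<Longrightarrow> linear (A y)" "\<And>y. y \<in> S \<Longrightarrow> linear (B y)"
    and AB: "\<And>y v. y \<in> S \<Longrightarrow> A y (B y v) = v"
    and c: "c > 0" "\<And>y v. y \<in> S \<Longrightarrow> c * norm v \<le> norm (A y v)"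
    and A: "\<And>v. Ck_on k S (\<lambda>y. A y v)"
  shows "Ck_on k S (\<lambda>y. B y v)"
proof -
  have Bn: "norm (B y w) \<le> norm w / c" if "y \<in> S" for y w
    using c(2)[OF that, of "B y w"] unfolding AB[OF that] pos_le_divide_eq[OF c(1)]
    by (simp only: mult.commute)
  \<comment> \<open>The resolvent identity, verified after applying \<open>A y\<close>, which is
    injective by the lower bound.\<close>
  have diff: "B y v - B x v = - B y (A y (B x v) - A x (B x v))" if "x \<in> S" "y \<in> S" for x y v
  proof -
    have inj: "u = w" if "A y u = A y w" for u w
      using c(2)[OF \<open>y \<in> S\<close>, of "u - w"] c(1) that
      unfolding linear_diff[OF lin(1)[OF \<open>y \<in> S\<close>]] by (simp add: mult_le_0_iff)
    show ?thesis
    proof (rule inj)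
      have "A y (B y v - B x v) = - (A y (B x v) - A x (B x v))"
        unfolding linear_diff[OF lin(1)[OF \<open>y \<in> S\<close>]] AB[OF \<open>x \<in> S\<close>] AB[OF \<open>y \<in> S\<close>] by simp
      also have "\<dots> = A y (- B y (A y (B x v) - A x (B x v)))"
        unfolding linear_neg[OF lin(1)[OF \<open>y \<in> S\<close>]] AB[OF \<open>y \<in> S\<close>] ..
      finally show "A y (B y v - B x v) = A y (- B y (A y (B x v) - A x (B x v)))" .
    qed
  qed
  have exp: "L w = (\<Sum>b\<in>Basis. (w \<bullet> b) *\<^sub>R L b)" if "linear L" for L :: "'a \<Rightarrow> 'a" and w
  proof -
    have "L (\<Sum>b\<in>Basis. (w \<bullet> b) *\<^sub>R b) = (\<Sum>b\<in>Basis. (w \<bullet> b) *\<^sub>R L b)"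
      unfolding linear_sum[OF that] linear_scale[OF that] ..
    then show ?thesis unfolding euclidean_representation .
  qed
  have cont: "continuous_on S (\<lambda>y. B y v)" if A0: "\<And>v. continuous_on S (\<lambda>y. A y v)" for v
  proof (rule continuous_at_imp_continuous_on, rule ballI)
    fix x assume x: "x \<in> S"
    have "((\<lambda>y. A y (B x v)) \<longlongrightarrow> A x (B x v)) (at x)"
      using A0 x S by (simp add: continuous_on_eq_continuous_at continuous_at)
    then have "((\<lambda>y. norm (A y (B x v) - A x (B x v)) / c) \<longlongrightarrow> 0) (at x)"
      using tendsto_divide_zero tendsto_norm_zero LIM_zero by blast
    then have "((\<lambda>y. B y v - B x v) \<longlongrightarrow> 0) (at x)"
    proof (rule Lim_null_comparison[rotated])
      show "\<forall>\<^sub>F y in at x. norm (B y v - B x v) \<le> norm (A y (B x v) - A x (B x v)) / c"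
        unfolding eventually_at_topological
      proof (intro exI[of _ S] conjI ballI impI S x)
        fix y assume y: "y \<in> S"
        show "norm (B y v - B x v) \<le> norm (A y (B x v) - A x (B x v)) / c"
          unfolding diff[OF x y] norm_minus_cancel by (rule Bn[OF y])
      qed
    qed
    then show "isCont (\<lambda>y. B y v) x"
      by (simp add: isCont_def Lim_null[symmetric])
  qed
  show ?thesis
    using A
  proof (induction k arbitrary: v)
    case 0
    then show ?case using cont by simp
  next
    case (Suc k)
    let ?A' = "\<lambda>x. \<lambda>b. frechet_derivative (\<lambda>y. A y b) (at x)"
    \<comment> \<open>This is minus \<open>B\<close> after the derivative of \<open>A\<close> after
      \<open>B\<close>, expanded in the basis so that \<open>B\<close> and the derivative of
      \<open>A\<close> are only evaluated at fixed vectors, as the induction hypothesis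
      requires.\<close>
    define D where "D x u = - (\<Sum>b\<in>Basis.
      ((\<Sum>e\<in>Basis. (B x v \<bullet> e) *\<^sub>R ?A' x e u) \<bullet> b) *\<^sub>R B x b)" for x u
    have IH: "Ck_on k S (\<lambda>y. B y v)" for v
      using Suc.IH Suc.prems Ck_on_SucD by blast
    show ?case
    proof (rule Ck_on_SucI[OF S])
      fix u show "Ck_on k S (\<lambda>x. D x u)"
        unfolding D_def using Suc.prems
        by (intro Ck_on_linear[OF _ bounded_linear_minus[OF bounded_linear_ident]]
            Ck_on_sum Ck_on_bilinear[OF _ bounded_bilinear_scaleR] IH S
            Ck_on_linear[OF _ bounded_linear_inner_left]) auto
    next
      fix x assume x: "x \<in> S"
      define w where "w = B x v"
      have dA: "((\<lambda>y. A y w - A x w) has_derivative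
          (\<lambda>u. \<Sum>e\<in>Basis. (w \<bullet> e) *\<^sub>R ?A' x e u)) (at x)"
      proof (rule has_derivative_transform_within_open[OF _ S x])
        have *: "((\<lambda>y. \<Sum>e\<in>Basis. (w \<bullet> e) *\<^sub>R A y e) has_derivative
          (\<lambda>u. \<Sum>e\<in>Basis. (w \<bullet> e) *\<^sub>R ?A' x e u)) (at x)"
          by (intro has_derivative_sum has_derivative_scaleR_right Ck_on_has_derivative[OF Suc.prems x])
        show "((\<lambda>y. (\<Sum>e\<in>Basis. (w \<bullet> e) *\<^sub>R A y e) - A x w) has_derivative
          (\<lambda>u. \<Sum>e\<in>Basis. (w \<bullet> e) *\<^sub>R ?A' x e u)) (at x)"
          using has_derivative_diff[OF * has_derivative_const] by simp
      qed (use exp[OF lin(1)] in auto)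
      show "((\<lambda>y. B y v) has_derivative D x) (at x)"
      proof (rule has_derivative_transform_within_open[OF _ S x])
        have "((\<lambda>y. B y v - B x v) has_derivative D x) (at x)"
        proof (rule has_derivative_transform_within_open[OF _ S x])
          \<comment> \<open>The first factor vanishes at \<open>y = x\<close>, so continuity of
            \<open>B y b\<close>, a consequence of the induction hypothesis, is enough for the
            product rule.\<close>
          show "((\<lambda>y. - (\<Sum>b\<in>Basis. ((A y w - A x w) \<bullet> b) *\<^sub>R B y b)) has_derivative D x) (at x)"
            unfolding D_def w_def[symmetric]
            by (intro has_derivative_minus has_derivative_sum has_derivative_scaleR_vanishing
                has_derivative_inner_left dA) 
              (use IH[THEN Ck_on_imp_continuous_on] S x in \<open>auto simp: continuous_on_eq_continuous_at\<close>)
        qed (use exp[OF lin(2)] diff[OF x] w_def in auto)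
        from has_derivative_add[OF this has_derivative_const[of "B x v"]]
        show "((\<lambda>y. B y v - B x v + B x v) has_derivative D x) (at x)" by simp
      qed simp
    qed
  qed
qed


text \<open>Along \<open>x + t *\<^sub>R v\<close> with small \<open>t\<close>, the increment of
  \<open>f\<close> is that of \<open>f'\<close> up to an error that is small relative to
  \<open>t\<close>; dividing by \<open>t\<close> transfers the expansion bound to
  \<open>f'\<close>.\<close>

lemma has_derivative_norm_ge:
  fixes f :: "'a::real_normed_vector \<Rightarrow> 'b::real_normed_vector"
  assumes f: "(f has_derivative f') (at x)" and S: "open S" "x \<in> S"
    and c: "\<And>y. y \<in> S \<Longrightarrow> c * norm (y - x) \<le> norm (f y - f x)"
  shows "c * norm v \<le> norm (f' v)"
proof (cases "v = 0")
  case True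
  then show ?thesis by simp
next
  case False
  interpret bounded_linear f' using f by (rule has_derivative_bounded_linear)
  show ?thesis
  proof (rule field_le_epsilon)
    fix e :: real assume "e > 0"
    define e' where "e' = e / norm v"
    have e': "e' > 0" using \<open>e > 0\<close> False by (simp add: e'_def)
    obtain d where d: "d > 0" "\<And>y. norm (y - x) < d \<Longrightarrow> norm (f y - f x - f' (y - x)) \<le> e' * norm (y - x)"
      using f e' unfolding has_derivative_at_alt by blast
    obtain r where r: "r > 0" "ball x r \<subseteq> S" using S openE by blast
    \<comment> \<open>The step has length half of \<open>min d r\<close>, so the point stays in
      \<open>S\<close> and in the range of the derivative estimate.\<close>
    define t where "t = min d r / (2 * norm v)"
    have t: "t > 0" using d(1) r(1) False by (simp add: t_def)
    have "t * norm v < d" "t * norm v < r" using d(1) r(1) False by (auto simp: t_def min_def)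
    then have "x + t *\<^sub>R v \<in> S" "norm (f (x + t *\<^sub>R v) - f x - f' (t *\<^sub>R v)) \<le> e' * norm (t *\<^sub>R v)"
      using r d(2)[of "x + t *\<^sub>R v"] t by (auto simp: dist_norm)
    moreover note c[OF this(1)]
    ultimately have "c * norm (t *\<^sub>R v) \<le> norm (f' (t *\<^sub>R v)) + e' * norm (t *\<^sub>R v)"
      using norm_triangle_ineq2[of "f (x + t *\<^sub>R v) - f x" "f' (t *\<^sub>R v)"] by simp
    then have "t * (c * norm v) \<le> t * (norm (f' v) + e' * norm v)"
      using t by (simp add: scaleR algebra_simps)
    then show "c * norm v \<le> norm (f' v) + e"
      using t False by (simp add: e'_def)
  qed
qed

text \<open>The expansion bound gives injectivity and a Lipschitz inverse at once, and it passes to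
  the derivatives, whose inverses are therefore uniformly bounded.\<close>

lemma diffeomorphic_expanding:
  fixes f :: "'a::euclidean_space \<Rightarrow> 'a"
  assumes S: "open S" and T: "open T" and im: "f ` S = T" and f: "\<And>k. Ck_on k S f"
    and c: "c > 0" "\<And>x y. x \<in> S \<Longrightarrow> y \<in> S \<Longrightarrow> c * norm (y - x) \<le> norm (f y - f x)"
  shows "diffeomorphic S T"
proof -
  have "inj_on f S"
  proof (rule inj_onI)
    fix x y assume "x \<in> S" "y \<in> S" "f x = f y"
    then show "x = y" using c(1) c(2)[of x y] by (simp add: mult_le_0_iff)
  qed
  define g where "g = inv_into S f"
  have g: "g y \<in> S" "f (g y) = y" if "y \<in> T" for y
    using that im by (auto simp: g_def inv_into_into f_inv_into_f)
  have gf: "g (f x) = x" if "x \<in> S" for x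
    using \<open>inj_on f S\<close> that by (simp add: g_def)
  have img: "g ` T = S"
    using im gf g(1) by force
  have contg: "continuous_on T g"
    unfolding continuous_on_iff
  proof (intro ballI allI impI)
    fix y e :: real and z assume "z \<in> T" "e > (0::real)"
    show "\<exists>d>0. \<forall>y\<in>T. dist y z < d \<longrightarrow> dist (g y) (g z) < e"
    proof (intro exI[of _ "c * e"] conjI ballI impI)
      fix y assume y: "y \<in> T" "dist y z < c * e"
      then have "c * dist (g y) (g z) < c * e"
        using c(2)[of "g z" "g y"] g \<open>z \<in> T\<close> by (simp add: dist_norm)
      then show "dist (g y) (g z) < e" using c(1) by simp
    qed (use c(1) \<open>e > 0\<close> in simp)
  qed
  define A where "A y = frechet_derivative f (at (g y))" for y
  have dA: "(f has_derivative A y) (at (g y))" if "y \<in> T" for y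
    unfolding A_def by (rule Ck_on_has_derivative[OF f g(1)[OF that]])
  have linA: "linear (A y)" if "y \<in> T" for y
    using dA[OF that] has_derivative_linear by blast
  have An: "c * norm v \<le> norm (A y v)" if "y \<in> T" for y v
    using has_derivative_norm_ge[OF dA[OF that] S g(1)[OF that] c(2)] g(1)[OF that] by blast
  \<comment> \<open>In finite dimension an injective endomorphism is invertible.\<close>
  have "\<exists>B. linear B \<and> (\<forall>v. B (A y v) = v) \<and> (\<forall>v. A y (B v) = v)" if "y \<in> T" for y
  proof (rule linear_injective_isomorphism[OF linA[OF that]])
    have "v = 0" if "A y v = 0" for v
      using An[OF \<open>y \<in> T\<close>, of v] that c(1) by (simp add: mult_le_0_iff)
    then show "inj (A y)"
      using linear_injective_0[OF linA[OF that]] by blast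
  qed (rule refl)
  then obtain B where B: "\<And>y. y \<in> T \<Longrightarrow> linear (B y)" "\<And>y v. y \<in> T \<Longrightarrow> B y (A y v) = v"
    "\<And>y v. y \<in> T \<Longrightarrow> A y (B y v) = v"
    by metis
  have dg: "(g has_derivative B y) (at y)" if "y \<in> T" for y
  proof (rule has_derivative_inverse_basic[where f = f and g = g, OF dA[OF that] _ _ _ T that])
    show "bounded_linear (B y)" using B(1)[OF that] linear_conv_bounded_linear by blast
    show "B y \<circ> A y = id" using B(2)[OF that] by auto
    show "continuous (at y) g" using contg T that by (simp add: continuous_on_eq_continuous_at)
  qed (rule g(2))
  \<comment> \<open>Bootstrapping: if \<open>g\<close> has order \<open>k\<close>, so has
    \<open>A\<close>, the derivative of \<open>f\<close> composed with \<open>g\<close>; hence so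
    has its inverse \<open>B\<close>, which is the derivative of \<open>g\<close>.\<close>
  have "Ck_on k T g" for k
  proof (induction k)
    case 0
    then show ?case using contg by simp
  next
    case (Suc k)
    have "Ck_on k T (\<lambda>y. frechet_derivative f (at (g y)) v)" for v
      using f[of "Suc k"] img
      by (intro Ck_on_comp[OF T, where f = g and T = S and g = "\<lambda>x. frechet_derivative f (at x) v"] Suc) auto
    then have "\<And>v. Ck_on k T (\<lambda>y. A y v)"
      unfolding A_def .
    note Ck_on_linear_inverse[OF T linA B(1) B(3) c(1) An this]
    from Ck_on_SucI[OF T dg this] show ?case .
  qed
  then show ?thesis
    unfolding diffeomorphic_def smooth_on_def using S T f im img gf g(2) by blast
qed

text \<open>Solving \<open>x + g x = y\<close> means finding a fixed point of the contraction
  sending \<open>x\<close> to \<open>y - g x\<close>.\<close>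

lemma surj_add_contraction:
  fixes g :: "'a::banach \<Rightarrow> 'a"
  assumes "0 \<le> c" "c < 1" "\<And>x y. norm (g x - g y) \<le> c * norm (x - y)"
  shows "surj (\<lambda>x. x + g x)"
proof (rule surjI)
  fix y
  have "\<exists>!x. y - g x = x"
    using assms(3) by (intro banach_fix_type[OF assms(1,2)]) (simp add: dist_norm norm_minus_commute)
  then have "\<exists>x. y = x + g x" by (metis diff_add_cancel)
  then show "(\<lambda>y. SOME x. y = x + g x) y + g ((\<lambda>y. SOME x. y = x + g x) y) = y"
    by (metis (mono_tags, lifting) someI_ex)
qed

section \<open>Frames of normal vectors and a homogeneous partition of unity\<close>

lemma norm_vec_le_sum: "norm (x :: 'a::real_normed_vector^'n) \<le> (\<Sum>i\<in>UNIV. norm (x $ i))"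
  unfolding norm_vec_def by (rule L2_set_le_sum) simp

lemma bounded_bilinear_scalar_product:
  "bounded_bilinear (scalar_product :: complex^'n \<Rightarrow> complex^'n \<Rightarrow> complex)"
proof
  show "\<exists>K. \<forall>a b. norm (scalar_product a b :: complex) \<le> norm (a :: complex^'n) * norm (b :: complex^'n) * K"
  proof (intro exI[of _ "real CARD('n)"] allI)
    fix a b :: "complex^'n"
    have "norm (scalar_product a b) \<le> (\<Sum>i\<in>UNIV. norm (a $ i * b $ i))"
      unfolding scalar_product_def by (rule norm_sum)
    also have "\<dots> \<le> (\<Sum>i\<in>(UNIV::'n set). norm a * norm b)"
      unfolding norm_mult by (intro sum_mono mult_mono Finite_Cartesian_Product.norm_nth_le) auto
    finally show "norm (scalar_product a b) \<le> norm a * norm b * real CARD('n)"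
      by (simp add: mult_ac)
  qed
qed (simp_all add: scalar_product_def algebra_simps sum.distrib scaleR_right.sum)

interpretation scalar_product: bounded_bilinear "scalar_product :: complex^'n \<Rightarrow> complex^'n \<Rightarrow> complex"
  by (rule bounded_bilinear_scalar_product)

lemma matrix_vector_mult_nth: "(A *v x) $ i = scalar_product (A $ i) x"
  by (simp add: matrix_vector_mult_def scalar_product_def)

lemma bounded_bilinear_matrix_vector_mult:
  "bounded_bilinear ((*v) :: complex^'n^'m \<Rightarrow> complex^'n \<Rightarrow> complex^'m)"
proof
  obtain K where K: "\<And>a b. norm (scalar_product a b) \<le> norm (a::complex^'n) * norm b * K" "K > 0"
    using scalar_product.pos_bounded by blast
  show "\<exists>K. \<forall>a b. norm (a *v b) \<le> norm (a :: complex^'n^'m) * norm (b :: complex^'n) * K"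
  proof (intro exI[of _ "K * real CARD('m)"] allI)
    fix a :: "complex^'n^'m" and b :: "complex^'n"
    have "norm (a *v b) \<le> (\<Sum>i\<in>UNIV. norm (scalar_product (a $ i) b))"
      using norm_vec_le_sum[of "a *v b"] by (simp add: matrix_vector_mult_nth)
    also have "\<dots> \<le> (\<Sum>i\<in>(UNIV::'m set). norm a * norm b * K)"
    proof (rule sum_mono)
      fix i
      have "norm (scalar_product (a $ i) b) \<le> norm (a $ i) * norm b * K" by (rule K)
      also have "\<dots> \<le> norm a * norm b * K"
        using K(2) by (intro mult_right_mono Finite_Cartesian_Product.norm_nth_le) auto
      finally show "norm (scalar_product (a $ i) b) \<le> norm a * norm b * K" .
    qed
    finally show "norm (a *v b) \<le> norm a * norm b * (K * real CARD('m))"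
      by (simp add: mult_ac)
  qed
qed (vector matrix_vector_mult_def algebra_simps sum.distrib scaleR_right.sum)+

interpretation matrix_vector_mult: bounded_bilinear "(*v) :: complex^'n^'m \<Rightarrow> complex^'n \<Rightarrow> complex^'m"
  by (rule bounded_bilinear_matrix_vector_mult)

lemma matrix_inv_works:
  assumes "invertible A"
  shows "A ** matrix_inv A = mat 1" "matrix_inv A ** A = mat 1"
  using assms someI_ex[of "\<lambda>B. A ** B = mat 1 \<and> B ** A = mat 1"]
  unfolding invertible_def matrix_inv_def by blast+

text \<open>
  A frame selects \<open>r = card D\<close> normals, to be the rows with index in \<open>D\<close> of a square matrix whose
  other rows are standard basis vectors. Normals supported on \<open>D\<close> thus keep spanning the same
  \<open>r\<close>-dimensional space when they move, even if \<open>r\<close> is smaller than the ambient dimension.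
\<close>

definition normals_complement :: "nat \<Rightarrow> (nat \<Rightarrow> complex^'d) \<Rightarrow> (complex^'d) set" where
  "normals_complement m n = {x. \<forall>i\<in>{1..m}. scalar_product (n i) x \<noteq> 0}"

text \<open>Normals supported on \<open>D\<close> see a point only through this projection. Its norm
  replaces that of the point in all estimates, since the forms cannot control the remaining
  coordinates.\<close>

definition coord_proj :: "'d set \<Rightarrow> complex^'d \<Rightarrow> complex^'d" where
  "coord_proj D x = (\<chi> j. if j \<in> D then x $ j else 0)"

text \<open>Frames are ordered: a set of \<open>card D\<close> indices occurs once for each
  bijection from \<open>D\<close>. This is harmless because the weights are normalised over all
  frames. Extensionality makes the collection finite.\<close>

definition frames :: "'d set \<Rightarrow> nat \<Rightarrow> ('d \<Rightarrow> nat) set" where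
  "frames D m = {t \<in> D \<rightarrow>\<^sub>E {1..m}. inj_on t D}"

definition frame_matrix :: "'d set \<Rightarrow> (nat \<Rightarrow> complex^'d) \<Rightarrow> ('d \<Rightarrow> nat) \<Rightarrow> complex^'d^'d" where
  "frame_matrix D n t = (\<chi> j. if j \<in> D then n (t j) else axis j 1)"

definition supported_on :: "'d set \<Rightarrow> complex^'d \<Rightarrow> bool" where
  "supported_on D a \<longleftrightarrow> (\<forall>j. j \<notin> D \<longrightarrow> a $ j = 0)"

lemma open_normals_complement: "open (normals_complement m n)"
proof -
  have "normals_complement m n = (\<Inter>i\<in>{1..m}. {x. scalar_product (n i) x \<noteq> 0})"
    by (auto simp: normals_complement_def)
  moreover have "open {x. scalar_product (n i) x \<noteq> 0}" for i
    by (intro open_Collect_neq continuous_intros scalar_product.continuous_on)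
  ultimately show ?thesis by auto
qed

lemma finite_frames: "finite (frames (D :: 'd::finite set) m)"
  unfolding frames_def by (rule finite_subset[of _ "D \<rightarrow>\<^sub>E {1..m}"]) (auto intro: finite_PiE)

lemma bounded_linear_coord_proj: "bounded_linear (coord_proj D)"
  unfolding linear_conv_bounded_linear[symmetric]
  by (rule linearI) (auto simp: coord_proj_def vec_eq_iff)

lemma coord_proj_diff: "coord_proj D (x - y) = coord_proj D x - coord_proj D y"
  by (simp add: coord_proj_def vec_eq_iff)

lemma norm_coord_proj_le: "norm (coord_proj D x) \<le> norm x"
  unfolding norm_vec_def coord_proj_def by (rule L2_set_mono) auto

lemma scalar_product_coord_proj:
  "supported_on D a \<Longrightarrow> scalar_product a (coord_proj D x) = scalar_product a x"
  by (auto simp: scalar_product_def coord_proj_def supported_on_def intro!: sum.cong)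

lemma scalar_product_axis: "scalar_product (axis j 1) x = (x $ j :: 'a::comm_semiring_1)"
  by (simp add: scalar_product_def axis_def if_distrib[of "\<lambda>u. u * _"] cong: if_cong)

lemma frame_matrix_mult_coord_proj:
  "(frame_matrix D n t *v coord_proj D x) $ j
    = (if j \<in> D then scalar_product (n (t j)) (coord_proj D x) else 0)"
  by (simp add: matrix_vector_mult_nth frame_matrix_def scalar_product_axis) (simp add: coord_proj_def)

text \<open>The determinant condition is uniformity of rank \<open>card D\<close>: given the
  supports and the basis rows off \<open>D\<close>, a frame matrix is invertible exactly when its
  selected normals are independent. In this form it is a polynomial condition on the
  normals.\<close>

locale generic_normals =
  fixes m :: nat and D :: "'d::finite set" and n :: "nat \<Rightarrow> complex^'d"
  assumes m: "1 \<le> m" and cardD: "card D \<le> m"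
    and supp: "\<And>i. i \<in> {1..m} \<Longrightarrow> supported_on D (n i)"
    and det: "\<And>t. t \<in> frames D m \<Longrightarrow> det (frame_matrix D n t) \<noteq> 0"
begin

abbreviation "l i x \<equiv> scalar_product (n i) x"
abbreviation "p \<equiv> coord_proj D"
abbreviation "F \<equiv> frames D m"

text \<open>
  The weight \<open>\<phi> t\<close> vanishes on the hyperplanes outside the frame \<open>t\<close>. All \<open>\<psi> t\<close> are homogeneous of
  the same degree and have no common zero outside the kernel of \<open>p\<close>, because fewer than \<open>card D\<close> of
  the linear forms are small at a given point; on that kernel \<open>\<phi> t\<close> is the junk value of a quotient
  by \<open>\<Psi> x\<close> and is only ever used multiplied by \<open>p x\<close>.
\<close>

definition sq :: "nat \<Rightarrow> complex^'d \<Rightarrow> real" where "sq i x = (norm (l i x))\<^sup>2"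
definition \<psi> :: "('d \<Rightarrow> nat) \<Rightarrow> complex^'d \<Rightarrow> real" where "\<psi> t x = (\<Prod>i\<in>{1..m} - t ` D. sq i x)"
definition \<Psi> :: "complex^'d \<Rightarrow> real" where "\<Psi> x = (\<Sum>t\<in>F. \<psi> t x)"
definition \<phi> :: "('d \<Rightarrow> nat) \<Rightarrow> complex^'d \<Rightarrow> real" where "\<phi> t x = \<psi> t x / \<Psi> x"
abbreviation "N \<equiv> m - card D"

section \<open>Bounds for the linear forms and the total weight\<close>

lemma l_proj: "i \<in> {1..m} \<Longrightarrow> l i (p x) = l i x"
  using supp by (rule scalar_product_coord_proj)

lemma upper_bound: obtains K where "K > 0" "\<And>i x. i \<in> {1..m} \<Longrightarrow> norm (l i x) \<le> K * norm (p x)"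
proof -
  obtain C where C: "C > 0" "\<And>a b. norm (scalar_product a b) \<le> norm (a::complex^'d) * norm b * C"
    using scalar_product.pos_bounded by blast
  show thesis
  proof (rule that)
    show "1 + (\<Sum>i\<in>{1..m}. norm (n i)) * C > 0"
      using C(1) by (simp add: add_pos_nonneg sum_nonneg)
  next
    fix i x assume i: "i \<in> {1..m}"
    have "norm (l i x) \<le> norm (n i) * norm (p x) * C"
      using C(2)[of "n i" "p x"] l_proj[OF i] by simp
    also have "\<dots> \<le> (\<Sum>i\<in>{1..m}. norm (n i)) * norm (p x) * C"
      using C(1) member_le_sum[OF i, of "\<lambda>i. norm (n i)"]
      by (intro mult_right_mono) auto
    also have "\<dots> \<le> (1 + (\<Sum>i\<in>{1..m}. norm (n i)) * C) * norm (p x)"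
      using norm_ge_zero[of "p x"] by (simp add: algebra_simps)
    finally show "norm (l i x) \<le> (1 + (\<Sum>i\<in>{1..m}. norm (n i)) * C) * norm (p x)" .
  qed
qed

text \<open>The inverse frame matrix recovers \<open>p x\<close> from the values of the frame's
  forms. As there are finitely many frames, summing the norms of these inverses gives one constant
  for all.\<close>

lemma frame_bound:
  obtains \<kappa> where "\<kappa> > 0" "\<And>t x. t \<in> F \<Longrightarrow> norm (p x) \<le> \<kappa> * (\<Sum>j\<in>D. norm (l (t j) x))"
proof -
  obtain C where C: "C > 0" "\<And>a b. norm (a *v b) \<le> norm (a::complex^'d^'d) * norm b * C"
    using matrix_vector_mult.pos_bounded by blast
  define \<mu> where "\<mu> t = norm (matrix_inv (frame_matrix D n t))" for t
  show thesis
  proof (rule that)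
    show "1 + (\<Sum>t\<in>F. \<mu> t) * C > 0"
      using C(1) by (simp add: add_pos_nonneg sum_nonneg \<mu>_def)
  next
    fix t x assume t: "t \<in> F"
    let ?M = "frame_matrix D n t"
    have "invertible ?M" using det[OF t] invertible_det_nz by blast
    then have "matrix_inv ?M *v (?M *v p x) = p x"
      by (simp add: matrix_vector_mul_assoc matrix_inv_works)
    then have "norm (p x) \<le> \<mu> t * norm (?M *v p x) * C"
      using C(2)[of "matrix_inv ?M" "?M *v p x"] by (simp add: \<mu>_def)
    also have "\<dots> \<le> (\<Sum>t\<in>F. \<mu> t) * norm (?M *v p x) * C"
      using C(1) member_le_sum[OF t, of \<mu>] finite_frames
      by (intro mult_right_mono) (auto simp: \<mu>_def)
    also have "\<dots> \<le> (1 + (\<Sum>t\<in>F. \<mu> t) * C) * norm (?M *v p x)"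
      using norm_ge_zero[of "?M *v p x"] by (simp add: algebra_simps)
    also have "norm (?M *v p x) \<le> (\<Sum>j\<in>UNIV. norm ((?M *v p x) $ j))"
      by (rule norm_vec_le_sum)
    also have "\<dots> = (\<Sum>j\<in>D. norm (l (t j) x))"
    proof (rule sum.mono_neutral_cong_right)
      fix j assume j: "j \<in> D"
      then have "t j \<in> {1..m}" using t by (auto simp: frames_def)
      then show "norm ((?M *v p x) $ j) = norm (l (t j) x)"
        using j l_proj by (simp add: frame_matrix_mult_coord_proj)
    qed (auto simp: frame_matrix_mult_coord_proj)
    finally show "norm (p x) \<le> (1 + (\<Sum>t\<in>F. \<mu> t) * C) * (\<Sum>j\<in>D. norm (l (t j) x))"
      using C(1) by (simp add: add_pos_nonneg sum_nonneg \<mu>_def mult_left_mono)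
  qed
qed

lemma card_frame_compl: "t \<in> F \<Longrightarrow> card ({1..m} - t ` D) = N"
  by (subst card_Diff_subset) (auto simp: frames_def card_image)

lemma frame_of_set:
  assumes "I \<subseteq> {1..m}" "card I = card D"
  obtains t where "t \<in> F" "t ` D = I"
proof -
  have "finite I" using assms(1) finite_subset by blast
  then obtain h where h: "bij_betw h D I"
    using assms(2) finite_same_card_bij[of D I] by auto
  then show thesis
    using assms(1) by (intro that[of "restrict h D"])
      (auto simp: frames_def bij_betw_def inj_on_def)
qed

text \<open>By \<open>frame_bound\<close> the forms of a frame cannot all be small at
  \<open>x\<close>. Hence the indices of small forms fit into some frame \<open>t\<close>, and
  \<open>\<psi> t\<close> is a product of large factors only.\<close>

lemma \<Psi>_lower:
  obtains \<delta> where "\<delta> > 0" "\<And>x. p x \<noteq> 0 \<Longrightarrow> ((\<delta> * norm (p x))\<^sup>2) ^ N \<le> \<Psi> x"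
proof -
  obtain \<kappa> where \<kappa>: "\<kappa> > 0" "\<And>t x. t \<in> F \<Longrightarrow> norm (p x) \<le> \<kappa> * (\<Sum>j\<in>D. norm (l (t j) x))"
    using frame_bound by blast
  \<comment> \<open>Chosen so that \<open>card D\<close> forms below \<open>\<delta> * R\<close>
    would give \<open>R < R\<close> in \<open>frame_bound\<close>.\<close>
  define \<delta> where "\<delta> = 1 / (\<kappa> * card D + 1)"
  have \<delta>: "\<delta> > 0" "\<kappa> * card D * \<delta> < 1"
    using \<kappa>(1) by (auto simp: \<delta>_def field_simps add_pos_nonneg add_nonneg_pos)
  show thesis
  proof (rule that[OF \<delta>(1)])
    fix x assume "p x \<noteq> 0"
    define R where "R = norm (p x)"
    have R: "R > 0" using \<open>p x \<noteq> 0\<close> by (simp add: R_def)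
    define S where "S = {i\<in>{1..m}. norm (l i x) < \<delta> * R}"
    then have S_sub: "S \<subseteq> {1..m}" by auto
    have "card S < card D"
    proof (rule ccontr)
      assume "\<not> card S < card D"
      then obtain I where I: "I \<subseteq> S" "card I = card D" "finite I"
        by (meson linorder_not_less obtain_subset_with_card_n)
      then obtain t where t: "t \<in> F" "t ` D = I"
        using frame_of_set[of I] I(1) S_sub by blast
      have "R \<le> \<kappa> * (\<Sum>j\<in>D. norm (l (t j) x))"
        unfolding R_def by (rule \<kappa>(2)[OF t(1)])
      also have "\<dots> \<le> \<kappa> * (\<Sum>j\<in>D. \<delta> * R)"
        using \<kappa>(1) t(2) I(1) by (intro mult_left_mono sum_mono) (auto simp: S_def intro: less_imp_le)
      also have "\<dots> = (\<kappa> * card D * \<delta>) * R" by simp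
      also have "\<dots> < 1 * R" using \<delta>(2) R by (intro mult_strict_right_mono)
      finally show False by simp
    qed
    moreover note S_sub
    \<comment> \<open>Enlarging \<open>S\<close> to exactly \<open>card D\<close> indices makes it
      the range of a frame whose complement contains no small form.\<close>
    ultimately obtain I where I: "S \<subseteq> I" "I \<subseteq> {1..m}" "card I = card D"
      using exists_subset_between[of S "card D" "{1..m}"] cardD by auto
    then obtain t where t: "t \<in> F" "t ` D = I"
      using frame_of_set by blast
    have "((\<delta> * R)\<^sup>2) ^ N = (\<Prod>i\<in>{1..m} - t ` D. (\<delta> * R)\<^sup>2)"
      using card_frame_compl[OF t(1)] by simp
    also have "\<dots> \<le> \<psi> t x"
      unfolding \<psi>_def sq_def using I(1) t(2) \<delta>(1) R
      by (intro prod_mono) (auto simp: S_def intro!: power_mono)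
    also have "\<dots> \<le> \<Psi> x"
      unfolding \<Psi>_def using t(1) finite_frames
      by (intro member_le_sum) (auto simp: \<psi>_def sq_def intro!: prod_nonneg)
    finally show "((\<delta> * norm (p x))\<^sup>2) ^ N \<le> \<Psi> x" unfolding R_def .
  qed
qed

section \<open>Size and variation of the normalised weights\<close>

lemma \<psi>_nonneg: "0 \<le> \<psi> t x"
  unfolding \<psi>_def sq_def by (intro prod_nonneg) auto

lemma \<psi>_le_\<Psi>: "t \<in> F \<Longrightarrow> \<psi> t x \<le> \<Psi> x"
  unfolding \<Psi>_def using finite_frames \<psi>_nonneg by (intro member_le_sum) auto

lemma \<Psi>_nonneg: "0 \<le> \<Psi> x"
  unfolding \<Psi>_def by (intro sum_nonneg \<psi>_nonneg)

lemma \<phi>_nonneg: "0 \<le> \<phi> t x"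
  unfolding \<phi>_def by (intro divide_nonneg_nonneg \<psi>_nonneg \<Psi>_nonneg)

text \<open>This includes the points with \<open>\<Psi> x = 0\<close>, where the quotient has the
  value 0.\<close>

lemma \<phi>_le_1: "t \<in> F \<Longrightarrow> \<phi> t x \<le> 1"
  unfolding \<phi>_def using \<psi>_le_\<Psi>[of t x] \<Psi>_nonneg[of x] by (auto simp: divide_le_eq_1)

lemma \<Psi>_pos: "p x \<noteq> 0 \<Longrightarrow> 0 < \<Psi> x"
proof -
  assume "p x \<noteq> 0"
  obtain \<delta> where "\<delta> > 0" "((\<delta> * norm (p x))\<^sup>2) ^ N \<le> \<Psi> x"
    using \<Psi>_lower \<open>p x \<noteq> 0\<close> by metis
  moreover have "((\<delta> * norm (p x))\<^sup>2) ^ N > 0"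
    using \<open>p x \<noteq> 0\<close> \<open>\<delta> > 0\<close> by simp
  ultimately show ?thesis by linarith
qed

lemma sum_\<phi>: "p x \<noteq> 0 \<Longrightarrow> (\<Sum>t\<in>F. \<phi> t x) = 1"
  using \<Psi>_pos[of x] unfolding \<phi>_def sum_divide_distrib[symmetric] \<Psi>_def[symmetric] by simp

text \<open>The two bounds are brought to the common scale
  \<open>Q = (K * norm (p x))\<^sup>2\<close>: each \<open>sq i x / Q\<close> then lies between 0
  and 1, while \<open>\<Psi> x / Q ^ N\<close> stays above \<open>c\<close>.\<close>

lemma bounds:
  obtains K c where "K > 0" "c > 0"
    "\<And>i x. i \<in> {1..m} \<Longrightarrow> norm (l i x) \<le> K * norm (p x)"
    "\<And>x. p x \<noteq> 0 \<Longrightarrow> ((K * norm (p x))\<^sup>2) ^ N * c \<le> \<Psi> x"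
proof -
  obtain K where K: "K > 0" "\<And>i x. i \<in> {1..m} \<Longrightarrow> norm (l i x) \<le> K * norm (p x)"
    using upper_bound by blast
  obtain \<delta> where \<delta>: "\<delta> > 0" "\<And>x. p x \<noteq> 0 \<Longrightarrow> ((\<delta> * norm (p x))\<^sup>2) ^ N \<le> \<Psi> x"
    using \<Psi>_lower by blast
  have "((K * R)\<^sup>2) ^ N * ((\<delta> / K)\<^sup>2) ^ N = ((\<delta> * R)\<^sup>2) ^ N" for R
    using K(1) by (simp add: power_mult_distrib[symmetric] mult.commute)
  then show thesis
    using K \<delta> by (intro that[of K "((\<delta> / K)\<^sup>2) ^ N"]) auto
qed

lemma \<psi>_scaled: "t \<in> F \<Longrightarrow> Q \<noteq> 0 \<Longrightarrow> \<psi> t x = Q ^ N * (\<Prod>i\<in>{1..m} - t ` D. sq i x / Q)"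
  unfolding \<psi>_def prod_dividef prod_constant by (simp only: card_frame_compl) simp

text \<open>After rescaling, all factors of \<open>\<psi> t\<close> but the one of index
  \<open>i\<close> are bounded by 1, and the denominator is bounded below. This is how a frame that
  omits \<open>i\<close> loses its influence near hyperplane \<open>i\<close>.\<close>

lemma \<phi>_le_l:
  obtains C where "C > 0"
    "\<And>t i x. t \<in> F \<Longrightarrow> i \<in> {1..m} - t ` D \<Longrightarrow> p x \<noteq> 0 \<Longrightarrow> \<phi> t x * norm (p x) \<le> C * norm (l i x)"
proof -
  obtain K c where Kc: "K > 0" "c > 0"
    "\<And>i x. i \<in> {1..m} \<Longrightarrow> norm (l i x) \<le> K * norm (p x)"
    "\<And>x. p x \<noteq> 0 \<Longrightarrow> ((K * norm (p x))\<^sup>2) ^ N * c \<le> \<Psi> x"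
    using bounds by blast
  show thesis
  proof (rule that[of "1 / (c * K)"])
    fix t i x assume t: "t \<in> F" and i: "i \<in> {1..m} - t ` D" and x: "p x \<noteq> 0"
    define R where "R = norm (p x)"
    define Q where "Q = (K * R)\<^sup>2"
    have R: "R > 0" using x by (simp add: R_def)
    have Q: "Q > 0" using R Kc(1) by (simp add: Q_def)
    have s: "sq j x / Q = (norm (l j x) / (K * R))\<^sup>2" "norm (l j x) / (K * R) \<le> 1"
      "0 \<le> norm (l j x) / (K * R)"
      if "j \<in> {1..m}" for j
      using Kc(1) R Kc(3)[OF that, of x] by (simp_all add: sq_def Q_def power_divide R_def)
    have s1: "0 \<le> sq j x / Q \<and> sq j x / Q \<le> 1" if "j \<in> {1..m}" for j
      using s[OF that] by (simp add: power_le_one)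
    have "\<psi> t x = Q ^ N * ((sq i x / Q) * (\<Prod>j\<in>{1..m} - t ` D - {i}. sq j x / Q))"
      unfolding \<psi>_scaled[OF t less_imp_neq[OF Q, symmetric]]
      using i by (subst prod.remove[of _ i]) auto
    also have "\<dots> \<le> Q ^ N * ((sq i x / Q) * 1)"
      using Q s1 i by (intro mult_left_mono prod_le_1) auto
    \<comment> \<open>The square of a ratio in the unit interval is at most the ratio, which turns
      the quadratic weight into a linear bound.\<close>
    also have "sq i x / Q \<le> norm (l i x) / (K * R)"
      using s[of i] i power_le_one[of "norm (l i x) / (K * R)" 1]
        mult_left_le[of "norm (l i x) / (K * R)" "norm (l i x) / (K * R)"]
      unfolding power2_eq_square by simp
    finally have "\<psi> t x \<le> Q ^ N * (norm (l i x) / (K * R))"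
      using Q by (simp add: mult_left_mono)
    then have "\<phi> t x \<le> Q ^ N * (norm (l i x) / (K * R)) / \<Psi> x"
      unfolding \<phi>_def using \<Psi>_nonneg by (intro divide_right_mono)
    also have "\<dots> \<le> Q ^ N * (norm (l i x) / (K * R)) / (Q ^ N * c)"
      using Kc(4)[OF x] Q Kc(1,2) R \<Psi>_pos[OF x] unfolding Q_def R_def[symmetric]
      by (intro divide_left_mono mult_pos_pos) auto
    also have "\<dots> = norm (l i x) / (c * K * R)"
      using Q by simp
    finally have "\<phi> t x * R \<le> norm (l i x) / (c * K * R) * R"
      using R by (intro mult_right_mono) auto
    then show "\<phi> t x * norm (p x) \<le> 1 / (c * K) * norm (l i x)"
      using R by (simp add: R_def)
  qed (use Kc in simp)
qed

text \<open>Rescaled by the farther point \<open>x\<close>, the factors at both points lie in the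
  unit interval, where a difference of products is at most the sum of the differences of the
  factors.\<close>

lemma \<psi>_diff:
  assumes K: "K > 0" "\<And>i x. i \<in> {1..m} \<Longrightarrow> norm (l i x) \<le> K * norm (p x)"
    and t: "t \<in> F" and x: "p x \<noteq> 0" "norm (p y) \<le> norm (p x)"
  shows "\<bar>\<psi> t x - \<psi> t y\<bar> \<le> ((K * norm (p x))\<^sup>2) ^ N * (2 * m * norm (p x - p y) / norm (p x))"
proof -
  define R where "R = norm (p x)"
  define Q where "Q = (K * R)\<^sup>2"
  have R: "R > 0" using x by (simp add: R_def)
  have Q: "Q > 0" using R K(1) by (simp add: Q_def)
  let ?I = "{1..m} - t ` D"
  have lx: "norm (l j x) \<le> K * R" "norm (l j y) \<le> K * R" if "j \<in> {1..m}" for j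
    using K(2)[OF that, of x] K(2)[OF that, of y] mult_left_mono[OF x(2), of K] K(1)
    unfolding R_def by linarith+
  have s: "norm (sq j x / Q) \<le> 1" "norm (sq j y / Q) \<le> 1" if "j \<in> {1..m}" for j
    using lx[OF that] Q by (auto simp: sq_def Q_def power_mono)
  have d: "norm (sq j x / Q - sq j y / Q) \<le> 2 * norm (p x - p y) / R" if "j \<in> {1..m}" for j
  proof -
    \<comment> \<open>One factor is of size \<open>R\<close>, the other is Lipschitz; division by
      \<open>Q\<close> therefore leaves a single \<open>R\<close> in the denominator.\<close>
    have "sq j x - sq j y = (norm (l j x) + norm (l j y)) * (norm (l j x) - norm (l j y))"
      by (simp add: sq_def power2_eq_square algebra_simps)
    then have "\<bar>sq j x - sq j y\<bar> = (norm (l j x) + norm (l j y)) * \<bar>norm (l j x) - norm (l j y)\<bar>"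
      by (simp add: abs_mult)
    also have "\<dots> \<le> (2 * K * R) * (K * norm (p x - p y))"
    proof (rule mult_mono)
      show "norm (l j x) + norm (l j y) \<le> 2 * K * R" using lx[OF that] by simp
      have "\<bar>norm (l j x) - norm (l j y)\<bar> \<le> norm (l j (x - y))"
        unfolding scalar_product.diff_right by (rule norm_triangle_ineq3)
      also have "\<dots> \<le> K * norm (p x - p y)"
        using K(2)[OF that, of "x - y"] by (simp add: coord_proj_diff)
      finally show "\<bar>norm (l j x) - norm (l j y)\<bar> \<le> K * norm (p x - p y)" .
    qed (use K(1) R in auto)
    also have "\<dots> = (2 * norm (p x - p y) / R) * Q"
      using R by (simp add: Q_def power2_eq_square)
    finally show ?thesis
      using Q by (simp add: diff_divide_distrib[symmetric] divide_le_eq)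
  qed
  have "\<bar>\<psi> t x - \<psi> t y\<bar> = Q ^ N * norm ((\<Prod>i\<in>?I. sq i x / Q) - (\<Prod>i\<in>?I. sq i y / Q))"
    unfolding \<psi>_scaled[OF t less_imp_neq[OF Q, symmetric]] right_diff_distrib[symmetric]
    using Q by (simp add: abs_mult)
  also have "norm ((\<Prod>i\<in>?I. sq i x / Q) - (\<Prod>i\<in>?I. sq i y / Q))
    \<le> (\<Sum>i\<in>?I. norm (sq i x / Q - sq i y / Q))"
    using s by (intro norm_prod_diff) auto
  also have "\<dots> \<le> (\<Sum>i\<in>{1..m}. norm (sq i x / Q - sq i y / Q))"
    by (intro sum_mono2) auto
  also have "\<dots> \<le> (\<Sum>i\<in>{1..m}. 2 * norm (p x - p y) / R)"
    by (intro sum_mono d)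
  finally show ?thesis
    using Q by (simp add: mult_left_mono mult_ac R_def Q_def)
qed

text \<open>The weights have degree 0, so their variation is of order
  \<open>norm (p x - p y) / norm (p x)\<close>. Multiplication by \<open>p y\<close>, taken to be
  the shorter of the two projections, cancels the singular denominator.\<close>

lemma \<phi>_proj_Lipschitz:
  obtains L where "L > 0"
    "\<And>t x y. t \<in> F \<Longrightarrow> norm (\<phi> t x *\<^sub>R p x - \<phi> t y *\<^sub>R p y) \<le> L * norm (x - y)"
proof -
  obtain K c where Kc: "K > 0" "c > 0"
    "\<And>i x. i \<in> {1..m} \<Longrightarrow> norm (l i x) \<le> K * norm (p x)"
    "\<And>x. p x \<noteq> 0 \<Longrightarrow> ((K * norm (p x))\<^sup>2) ^ N * c \<le> \<Psi> x"
    using bounds by blast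
  define L where "L = 1 + (1 + real (card F)) * (2 * m / c)"
  have L: "L \<ge> 1" using Kc(2) by (simp add: L_def)
  have *: "norm (\<phi> t x *\<^sub>R p x - \<phi> t y *\<^sub>R p y) \<le> L * norm (p x - p y)"
    if t: "t \<in> F" and le: "norm (p y) \<le> norm (p x)" for t x y
  proof (cases "p y = 0")
    \<comment> \<open>Here \<open>\<phi> t y\<close> is a junk value, but it multiplies the zero
      vector.\<close>
    case True
    have "\<phi> t x * norm (p x) \<le> L * norm (p x)"
      using \<phi>_le_1[OF t, of x] L by (intro mult_right_mono) auto
    then show ?thesis using True \<phi>_nonneg[of t x] by simp
  next
    case False
    then have x: "p x \<noteq> 0" using le by auto
    define R where "R = norm (p x)"
    define q where "q = ((K * R)\<^sup>2) ^ N"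
    define e where "e = 2 * m * norm (p x - p y) / R"
    have R: "R > 0" using x by (simp add: R_def)
    have q: "q > 0" using R Kc(1) by (simp add: q_def)
    have e: "e \<ge> 0" using R by (simp add: e_def)
    have d: "\<bar>\<psi> s x - \<psi> s y\<bar> \<le> q * e" if "s \<in> F" for s
      using \<psi>_diff[OF Kc(1,3) that x le] by (simp add: q_def e_def R_def)
    have "\<bar>\<Psi> y - \<Psi> x\<bar> \<le> (\<Sum>s\<in>F. \<bar>\<psi> s y - \<psi> s x\<bar>)"
      unfolding \<Psi>_def sum_subtractf[symmetric] by (rule sum_abs)
    also have "\<dots> \<le> (\<Sum>s\<in>F. q * e)"
      by (intro sum_mono) (subst abs_minus_commute, rule d)
    finally have D: "\<bar>\<Psi> y - \<Psi> x\<bar> \<le> card F * (q * e)" by simp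
    have px: "\<Psi> x > 0" "\<Psi> y > 0" using \<Psi>_pos x False by auto
    \<comment> \<open>In this form only the total weight at the farther point \<open>x\<close> is a
      denominator, and that one is bounded below in terms of \<open>R\<close>.\<close>
    have "\<phi> t x - \<phi> t y = ((\<psi> t x - \<psi> t y) + \<phi> t y * (\<Psi> y - \<Psi> x)) / \<Psi> x"
      using px by (simp add: \<phi>_def field_simps)
    then have "\<bar>\<phi> t x - \<phi> t y\<bar> = \<bar>(\<psi> t x - \<psi> t y) + \<phi> t y * (\<Psi> y - \<Psi> x)\<bar> / \<Psi> x"
      using px by simp
    also have "\<dots> \<le> (q * e + card F * (q * e)) / \<Psi> x"
    proof (rule divide_right_mono)
      have "\<bar>\<phi> t y * (\<Psi> y - \<Psi> x)\<bar> \<le> 1 * \<bar>\<Psi> y - \<Psi> x\<bar>"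
        unfolding abs_mult using \<phi>_le_1[OF t, of y] \<phi>_nonneg[of t y] by (intro mult_right_mono) auto
      then show "\<bar>(\<psi> t x - \<psi> t y) + \<phi> t y * (\<Psi> y - \<Psi> x)\<bar> \<le> q * e + card F * (q * e)"
        using d[OF t] D abs_triangle_ineq[of "\<psi> t x - \<psi> t y" "\<phi> t y * (\<Psi> y - \<Psi> x)"]
        unfolding mult_1 by linarith
    qed (use px in simp)
    also have "\<dots> \<le> (q * e + card F * (q * e)) / (q * c)"
      using Kc(4)[OF x] q e px Kc(2) unfolding q_def R_def[symmetric]
      by (intro divide_left_mono) auto
    also have "\<dots> = (1 + real (card F)) * (2 * m / c) * norm (p x - p y) / R"
      using q Kc(2) R by (simp add: e_def field_simps)
    finally have f: "\<bar>\<phi> t x - \<phi> t y\<bar> \<le> (L - 1) * norm (p x - p y) / R"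
      by (simp add: L_def)
    have "\<phi> t x *\<^sub>R p x - \<phi> t y *\<^sub>R p y = \<phi> t x *\<^sub>R (p x - p y) + (\<phi> t x - \<phi> t y) *\<^sub>R p y"
      by (simp add: algebra_simps)
    then have "norm (\<phi> t x *\<^sub>R p x - \<phi> t y *\<^sub>R p y)
      \<le> \<phi> t x * norm (p x - p y) + \<bar>\<phi> t x - \<phi> t y\<bar> * norm (p y)"
      using norm_triangle_ineq[of "\<phi> t x *\<^sub>R (p x - p y)" "(\<phi> t x - \<phi> t y) *\<^sub>R p y"] \<phi>_nonneg[of t x]
      by simp
    also have "\<dots> \<le> 1 * norm (p x - p y) + (L - 1) * norm (p x - p y) / R * R"
      using f \<phi>_le_1[OF t, of x] le L R
      by (intro add_mono mult_mono) (auto simp: R_def)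
    also have "\<dots> = L * norm (p x - p y)"
      using R by (simp add: field_simps)
    finally show ?thesis .
  qed
  show thesis
  proof (rule that[of L])
    fix t x y assume t: "t \<in> F"
    have "norm (\<phi> t x *\<^sub>R p x - \<phi> t y *\<^sub>R p y) \<le> L * norm (p x - p y)"
      using *[OF t, of x y] *[OF t, of y x] by (metis linear norm_minus_commute)
    also have "\<dots> \<le> L * norm (x - y)"
      using L norm_coord_proj_le[of D "x - y"] unfolding coord_proj_diff
      by (intro mult_left_mono) auto
    finally show "norm (\<phi> t x *\<^sub>R p x - \<phi> t y *\<^sub>R p y) \<le> L * norm (x - y)" .
  qed (use L in simp)
qed

end

section \<open>Deforming one arrangement into a nearby one\<close>

text \<open>The squared norm is the inner product of a linear map with itself, which avoids square
  roots.\<close>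

lemma Ck_on_norm_scalar_product_squared:
  fixes a :: "complex^'d"
  assumes "open S"
  shows "Ck_on k S (\<lambda>x. (norm (scalar_product a x))\<^sup>2)"
proof -
  have "Ck_on k S (\<lambda>x. scalar_product a x)"
    by (intro Ck_on_linear[OF assms scalar_product.bounded_linear_right] Ck_on_ident assms)
  then have "Ck_on k S (\<lambda>x. scalar_product a x \<bullet> scalar_product a x)"
    by (intro Ck_on_bilinear[OF assms bounded_bilinear_inner])
  then show ?thesis by (simp add: power2_norm_eq_inner)
qed

context generic_normals
begin

text \<open>
  The linear map \<open>1 + E t\<close> carries the frame \<open>t\<close> of the given arrangement to that of the nearby one.
\<close>

definition deform :: "(('d \<Rightarrow> nat) \<Rightarrow> complex^'d^'d) \<Rightarrow> complex^'d \<Rightarrow> complex^'d" where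
  "deform E x = x + (\<Sum>t\<in>F. E t *v (\<phi> t x *\<^sub>R p x))"

lemma proj_nz:
  assumes "x \<in> normals_complement m n"
  shows "p x \<noteq> 0"
proof
  assume "p x = 0"
  have "l 1 x = l 1 (p x)" using l_proj[of 1 x] m by simp
  also have "\<dots> = 0" unfolding \<open>p x = 0\<close> by (rule scalar_product.zero_right)
  finally have "l 1 x = 0" .
  then show False using assms m by (auto simp: normals_complement_def)
qed

text \<open>The weights are quotients of real polynomials whose denominator is positive on the
  complement, for there \<open>p x\<close> is nonzero.\<close>

lemma Ck_on_deform: "Ck_on k (normals_complement m n) (deform E)"
proof -
  let ?S = "normals_complement m n"
  have S: "open ?S" by (rule open_normals_complement)
  have \<psi>: "Ck_on k ?S (\<psi> t)" for t
    unfolding \<psi>_def sq_def by (intro Ck_on_prod Ck_on_norm_scalar_product_squared S)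
  then have "Ck_on k ?S (\<lambda>x. inverse (\<Psi> x))"
    unfolding \<Psi>_def using \<Psi>_pos proj_nz
    by (intro Ck_on_inverse Ck_on_sum S) (force simp: \<Psi>_def)+
  then have "Ck_on k ?S (\<phi> t)" for t
    unfolding \<phi>_def divide_inverse by (intro Ck_on_bilinear[OF S bounded_bilinear_mult] \<psi>)
  moreover have "Ck_on k ?S p"
    by (intro Ck_on_linear[OF S bounded_linear_coord_proj] Ck_on_ident S)
  ultimately have "Ck_on k ?S (\<lambda>x. E t *v (\<phi> t x *\<^sub>R p x))" for t
    by (intro Ck_on_linear[OF S matrix_vector_mult.bounded_linear_right]
        Ck_on_bilinear[OF S bounded_bilinear_scaleR])
  then have "Ck_on k ?S (\<lambda>x. x + (\<Sum>t\<in>F. E t *v (\<phi> t x *\<^sub>R p x)))"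
    by (intro Ck_on_add Ck_on_sum S Ck_on_ident)
  then show ?thesis unfolding deform_def .
qed

text \<open>The displacement is linear in \<open>E\<close> and a sum over finitely many frames of
  Lipschitz maps, so one bound on all \<open>E t\<close> makes it a contraction.\<close>

lemma deform_Lipschitz:
  obtains e where "e > 0" "\<And>E x y. (\<And>t. t \<in> F \<Longrightarrow> norm (E t) \<le> e) \<Longrightarrow>
    norm ((deform E x - x) - (deform E y - y)) \<le> (1/2) * norm (x - y)"
proof -
  obtain C where C: "C > 0" "\<And>a b. norm (a *v b) \<le> norm (a::complex^'d^'d) * norm b * C"
    using matrix_vector_mult.pos_bounded by blast
  obtain L where L: "L > 0"
    "\<And>t x y. t \<in> F \<Longrightarrow> norm (\<phi> t x *\<^sub>R p x - \<phi> t y *\<^sub>R p y) \<le> L * norm (x - y)"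
    using \<phi>_proj_Lipschitz by blast
  \<comment> \<open>The \<open>card F\<close> summands, each with constant \<open>e * L * C\<close>,
    add up to at most one half; the successor keeps the denominator positive.\<close>
  define e where "e = 1 / (2 * (card F + 1) * L * C)"
  have "e * L * C = 1 / (2 * (card F + 1))"
    using C(1) L(1) by (simp add: e_def)
  then have e: "e > 0" "card F * (e * L * C) \<le> 1 / 2"
    using C(1) L(1) by (simp_all add: e_def)
  show thesis
  proof (rule that[OF e(1)])
    fix E :: "('d \<Rightarrow> nat) \<Rightarrow> complex^'d^'d" and x y
    assume E: "\<And>t. t \<in> F \<Longrightarrow> norm (E t) \<le> e"
    have "(deform E x - x) - (deform E y - y) = (\<Sum>t\<in>F. E t *v (\<phi> t x *\<^sub>R p x - \<phi> t y *\<^sub>R p y))"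
      by (simp add: deform_def sum_subtractf matrix_vector_mult.diff_right)
    also have "norm \<dots> \<le> (\<Sum>t\<in>F. e * L * C * norm (x - y))"
    proof (rule sum_norm_le)
      fix t assume t: "t \<in> F"
      have "norm (E t *v (\<phi> t x *\<^sub>R p x - \<phi> t y *\<^sub>R p y))
        \<le> norm (E t) * norm (\<phi> t x *\<^sub>R p x - \<phi> t y *\<^sub>R p y) * C" by (rule C)
      also have "\<dots> \<le> e * (L * norm (x - y)) * C"
        using E[OF t] L(2)[OF t] C(1) e(1) by (intro mult_right_mono mult_mono) auto
      finally show "norm (E t *v (\<phi> t x *\<^sub>R p x - \<phi> t y *\<^sub>R p y)) \<le> e * L * C * norm (x - y)"
        by (simp add: mult_ac)
    qed
    also have "\<dots> = (card F * (e * L * C)) * norm (x - y)" by simp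
    also have "\<dots> \<le> (1/2) * norm (x - y)"
      using e(2) by (intro mult_right_mono) auto
    finally show "norm ((deform E x - x) - (deform E y - y)) \<le> (1/2) * norm (x - y)" .
  qed
qed

text \<open>Since the weights sum to 1, the error for index \<open>i\<close> is the weighted mean of
  the errors \<open>u t\<close> of the single maps \<open>1 + E t\<close>. It vanishes for frames
  containing \<open>i\<close>; for the others the weight is bounded through \<open>l i x\<close>
  itself. An error relative to \<open>l i x\<close> is what makes both forms vanish
  together.\<close>

lemma deform_normals:
  obtains e where "e > 0"
    "\<And>E n' i x. (\<And>t. t \<in> F \<Longrightarrow> norm (E t) \<le> e) \<Longrightarrow>
      (\<And>i. i \<in> {1..m} \<Longrightarrow> supported_on D (n' i) \<and> norm (n' i - n i) \<le> e) \<Longrightarrow>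
      (\<And>t. t \<in> F \<Longrightarrow> frame_matrix D n' t ** (mat 1 + E t) = frame_matrix D n t) \<Longrightarrow>
      i \<in> {1..m} \<Longrightarrow>
      norm (scalar_product (n' i) (deform E x) - l i x) \<le> (1/2) * norm (l i x)"
proof -
  obtain C where C: "C > 0" "\<And>a b. norm (a *v b) \<le> norm (a::complex^'d^'d) * norm b * C"
    using matrix_vector_mult.pos_bounded by blast
  obtain C' where C': "C' > 0" "\<And>a b. norm (scalar_product a b) \<le> norm (a::complex^'d) * norm b * C'"
    using scalar_product.pos_bounded by blast
  obtain B where B: "B > 0" "\<And>t i x. t \<in> F \<Longrightarrow> i \<in> {1..m} - t ` D \<Longrightarrow> p x \<noteq> 0 \<Longrightarrow>
      \<phi> t x * norm (p x) \<le> B * norm (l i x)"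
    using \<phi>_le_l by blast
  define A where "A = 1 + (\<Sum>i\<in>{1..m}. norm (n i))"
  have A: "A > 0" by (simp add: A_def add_pos_nonneg sum_nonneg)
  \<comment> \<open>This makes \<open>norm (u t) \<le> e * W * norm (p x)\<close>; \<open>A\<close>
    bounds the nearby normals once \<open>e \<le> 1\<close>, hence the minimum with 1 below.\<close>
  define W where "W = A * C * C' + C'"
  have W: "W > 0" using A C(1) C'(1) by (simp add: W_def add_pos_pos)
  define e where "e = min 1 (1 / (2 * (card F + 1) * B * W))"
  have e: "e > 0" "e \<le> 1"
    using B(1) W by (auto simp: e_def)
  have "card F * (e * W * B) \<le> card F * (1 / (2 * (card F + 1) * B * W) * W * B)"
    using B(1) W by (intro mult_left_mono mult_right_mono) (auto simp: e_def)
  also have "1 / (2 * (card F + 1) * B * W) * W * B = 1 / (2 * (card F + 1))"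
    using B(1) W by simp
  also have "card F * (1 / (2 * (card F + 1))) \<le> 1 / (2 :: real)" by (simp add: field_simps)
  finally have eW: "card F * (e * W * B) \<le> 1 / 2" .
  show thesis
  proof (rule that[OF e(1)])
    fix E n' i x
    assume E: "\<And>t. t \<in> F \<Longrightarrow> norm (E t) \<le> e"
      and n': "\<And>i. i \<in> {1..m} \<Longrightarrow> supported_on D (n' i) \<and> norm (n' i - n i) \<le> e"
      and M: "\<And>t. t \<in> F \<Longrightarrow> frame_matrix D n' t ** (mat 1 + E t) = frame_matrix D n t"
      and i: "i \<in> {1..m}"
    let ?l' = "\<lambda>x. scalar_product (n' i) x"
    have l'_proj: "?l' (p x) = ?l' x" for x
      using n'[OF i] by (simp add: scalar_product_coord_proj)
    show "norm (?l' (deform E x) - l i x) \<le> (1/2) * norm (l i x)"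
    proof (cases "p x = 0")
      \<comment> \<open>On the kernel of \<open>p\<close> the weights need not sum to 1, but the
        displacement and both forms vanish.\<close>
      case True
      then have "deform E x = x"
        by (simp add: deform_def)
      moreover have "l i x = 0" "?l' x = 0"
        using l_proj[OF i, of x] l'_proj[of x] True by (simp_all add: scalar_product.zero_right)
      ultimately show ?thesis by simp
    next
      case False
      define u where "u t = ?l' (E t *v p x) + (?l' (p x) - l i (p x))" for t
      \<comment> \<open>Row \<open>j\<close> of the frame identity, with \<open>i = t j\<close>,
        says that \<open>1 + E t\<close> carries form \<open>i\<close> exactly.\<close>
      have zero: "u t = 0" if t: "t \<in> F" and it: "i \<in> t ` D" for t
      proof -
        obtain j where j: "j \<in> D" "i = t j" using it by blast
        have "frame_matrix D n' t *v ((mat 1 + E t) *v p x) = frame_matrix D n t *v p x"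
          using M[OF t] by (simp add: matrix_vector_mul_assoc)
        then have "(frame_matrix D n' t *v (p x + E t *v p x)) $ j = (frame_matrix D n t *v p x) $ j"
          by (simp add: matrix_vector_mult.add_left)
        then have "?l' (p x) + ?l' (E t *v p x) = l i (p x)"
          using j by (simp add: matrix_vector_mult_nth frame_matrix_def scalar_product.add_right)
        then show ?thesis by (simp add: u_def flip: \<open>_ = l i (p x)\<close>)
      qed
      have "?l' (deform E x) - l i x
        = (\<Sum>t\<in>F. \<phi> t x *\<^sub>R ?l' (E t *v p x)) + (?l' (p x) - l i (p x))"
        unfolding deform_def l'_proj l_proj[OF i] scalar_product.add_right scalar_product.sum_right
          matrix_vector_mult.scaleR_right scalar_product.scaleR_right by simp
      also have "?l' (p x) - l i (p x) = (\<Sum>t\<in>F. \<phi> t x *\<^sub>R (?l' (p x) - l i (p x)))"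
        unfolding scaleR_sum_left[symmetric] sum_\<phi>[OF False] by simp
      also have "(\<Sum>t\<in>F. \<phi> t x *\<^sub>R ?l' (E t *v p x)) + \<dots> = (\<Sum>t\<in>F. \<phi> t x *\<^sub>R u t)"
        by (simp only: u_def sum.distrib scaleR_add_right)
      also have "norm \<dots> \<le> (\<Sum>t\<in>F. e * W * B * norm (l i x))"
      proof (rule sum_norm_le)
        fix t assume t: "t \<in> F"
        show "norm (\<phi> t x *\<^sub>R u t) \<le> e * W * B * norm (l i x)"
        proof (cases "i \<in> t ` D")
          case True
          then show ?thesis using zero[OF t] e W B(1) by simp
        next
          case False
          have "norm (n' i) \<le> norm (n i) + norm (n' i - n i)"
            using norm_triangle_ineq[of "n i" "n' i - n i"] by simp
          also have "\<dots> \<le> A"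
            using n'[OF i] e(2) member_le_sum[OF i, of "\<lambda>i. norm (n i)"] by (simp add: A_def)
          finally have nA: "norm (n' i) \<le> A" .
          have "norm (?l' (E t *v p x)) \<le> norm (n' i) * norm (E t *v p x) * C'" by (rule C')
          also have "\<dots> \<le> A * (e * norm (p x) * C) * C'"
          proof (intro mult_right_mono mult_mono nA)
            have "norm (E t *v p x) \<le> norm (E t) * norm (p x) * C" by (rule C)
            also have "\<dots> \<le> e * norm (p x) * C"
              using E[OF t] C(1) by (intro mult_right_mono) auto
            finally show "norm (E t *v p x) \<le> e * norm (p x) * C" .
          qed (use A C'(1) in auto)
          finally have 1: "norm (?l' (E t *v p x)) \<le> A * (e * norm (p x) * C) * C'" .
          have "norm (?l' (p x) - l i (p x)) \<le> norm (n' i - n i) * norm (p x) * C'"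
            unfolding scalar_product.diff_left[symmetric] by (rule C')
          also have "\<dots> \<le> e * norm (p x) * C'"
            using n'[OF i] C'(1) by (intro mult_right_mono) auto
          finally have "norm (u t) \<le> A * (e * norm (p x) * C) * C' + e * norm (p x) * C'"
            unfolding u_def using 1 by (intro norm_triangle_le) linarith
          also have "\<dots> = e * W * norm (p x)" by (simp add: W_def algebra_simps)
          finally have "norm (\<phi> t x *\<^sub>R u t) \<le> \<phi> t x * (e * W * norm (p x))"
            using \<phi>_nonneg[of t x] by (simp add: mult_left_mono)
          also have "\<dots> = e * W * (\<phi> t x * norm (p x))" by simp
          also have "\<dots> \<le> e * W * (B * norm (l i x))"
            using B(2)[OF t _ \<open>p x \<noteq> 0\<close>, of i] False i e(1) W by (intro mult_left_mono) auto
          finally show ?thesis by (simp add: mult_ac)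
        qed
      qed
      also have "\<dots> = card F * (e * W * B) * norm (l i x)" by simp
      also have "\<dots> \<le> (1/2) * norm (l i x)"
        using eW by (intro mult_right_mono) auto
      finally show ?thesis .
    qed
  qed
qed

text \<open>On the whole space \<open>deform E\<close> is the identity plus a contraction, hence
  surjective and expanding. The relative error bound then makes the preimage of the new complement
  the old one.\<close>

lemma diffeomorphic_nearby:
  obtains e where "e > 0"
    "\<And>E n'. (\<And>t. t \<in> F \<Longrightarrow> norm (E t) \<le> e) \<Longrightarrow>
      (\<And>i. i \<in> {1..m} \<Longrightarrow> supported_on D (n' i) \<and> norm (n' i - n i) \<le> e) \<Longrightarrow>
      (\<And>t. t \<in> F \<Longrightarrow> frame_matrix D n' t ** (mat 1 + E t) = frame_matrix D n t) \<Longrightarrow>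
      diffeomorphic (normals_complement m n) (normals_complement m n')"
proof -
  obtain e1 where e1: "e1 > 0" "\<And>E x y. (\<And>t. t \<in> F \<Longrightarrow> norm (E t) \<le> e1) \<Longrightarrow>
    norm ((deform E x - x) - (deform E y - y)) \<le> (1/2) * norm (x - y)"
    using deform_Lipschitz by blast
  obtain e2 where e2: "e2 > 0"
    "\<And>E n' i x. (\<And>t. t \<in> F \<Longrightarrow> norm (E t) \<le> e2) \<Longrightarrow>
      (\<And>i. i \<in> {1..m} \<Longrightarrow> supported_on D (n' i) \<and> norm (n' i - n i) \<le> e2) \<Longrightarrow>
      (\<And>t. t \<in> F \<Longrightarrow> frame_matrix D n' t ** (mat 1 + E t) = frame_matrix D n t) \<Longrightarrow>
      i \<in> {1..m} \<Longrightarrow>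
      norm (scalar_product (n' i) (deform E x) - l i x) \<le> (1/2) * norm (l i x)"
    using deform_normals by blast
  show thesis
  proof (rule that[of "min e1 e2"])
    fix E n'
    assume E: "\<And>t. t \<in> F \<Longrightarrow> norm (E t) \<le> min e1 e2"
      and n': "\<And>i. i \<in> {1..m} \<Longrightarrow> supported_on D (n' i) \<and> norm (n' i - n i) \<le> min e1 e2"
      and M: "\<And>t. t \<in> F \<Longrightarrow> frame_matrix D n' t ** (mat 1 + E t) = frame_matrix D n t"
    define g where "g x = deform E x - x" for x
    have g: "norm (g x - g y) \<le> (1/2) * norm (x - y)" for x y
      unfolding g_def using E by (intro e1) auto
    have close: "norm (scalar_product (n' i) (deform E x) - l i x) \<le> (1/2) * norm (l i x)"
      if "i \<in> {1..m}" for i x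
      using E n' by (intro e2 M that) auto
    \<comment> \<open>A number within half the modulus of \<open>l i x\<close> from
      \<open>l i x\<close> is zero only if \<open>l i x\<close> is.\<close>
    then have "scalar_product (n' i) (deform E x) = 0 \<longleftrightarrow> l i x = 0" if "i \<in> {1..m}" for i x
      using close[OF that, of x] by auto
    then have iff: "deform E x \<in> normals_complement m n' \<longleftrightarrow> x \<in> normals_complement m n" for x
      by (simp add: normals_complement_def)
    have "surj (\<lambda>x. x + g x)"
      by (rule surj_add_contraction[OF _ _ g]) auto
    then have surj: "surj (deform E)" by (simp add: g_def)
    have im: "deform E ` normals_complement m n = normals_complement m n'"
    proof (intro equalityI subsetI)
      fix y assume y: "y \<in> normals_complement m n'"
      obtain x where "y = deform E x" using surj by blast
      then show "y \<in> deform E ` normals_complement m n" using y iff by blast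
    qed (use iff in blast)
    show "diffeomorphic (normals_complement m n) (normals_complement m n')"
    proof (rule diffeomorphic_expanding[OF open_normals_complement open_normals_complement im Ck_on_deform])
      fix x y
      have "norm (y - x) = norm ((deform E y - deform E x) - (g y - g x))" by (simp add: g_def)
      also have "\<dots> \<le> norm (deform E y - deform E x) + norm (g y - g x)" by (rule norm_triangle_ineq4)
      finally show "1/2 * norm (y - x) \<le> norm (deform E y - deform E x)"
        using g[of y x] by simp
    qed simp
  qed (use e1 e2 in simp)
qed

end

section \<open>Connecting two arrangements\<close>

lemma tendsto_matrix:
  fixes f :: "'a \<Rightarrow> complex^'n^'m"
  assumes "\<And>i j. ((\<lambda>x. f x $ i $ j) \<longlongrightarrow> A $ i $ j) G"
  shows "(f \<longlongrightarrow> A) G"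
  by (intro vec_tendstoI assms)

lemma tendsto_det:
  fixes f :: "'a \<Rightarrow> complex^'n^'n"
  assumes "(f \<longlongrightarrow> A) G"
  shows "((\<lambda>x. det (f x)) \<longlongrightarrow> det A) G"
  unfolding det_def by (intro tendsto_intros assms)

text \<open>Cramer's rule makes the entries of the inverse quotients of determinants, from which
  continuity of inversion is read off.\<close>

lemma matrix_inv_cramer:
  fixes A :: "complex^'n^'n"
  assumes "det A \<noteq> 0"
  shows "matrix_inv A $ i $ k = det (\<chi> r s. if s = i then axis k 1 $ r else A $ r $ s) / det A"
proof -
  have "A *v (matrix_inv A *v axis k 1) = axis k 1"
    using assms by (simp add: matrix_vector_mul_assoc matrix_inv_works invertible_det_nz)
  then have "matrix_inv A *v axis k 1
    = (\<chi> i. det (\<chi> r s. if s = i then axis k 1 $ r else A $ r $ s) / det A)"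
    using cramer[OF assms] by blast
  moreover have "(matrix_inv A *v axis k 1) $ i = matrix_inv A $ i $ k"
    by (simp add: matrix_vector_mult_def axis_def if_distrib[of "\<lambda>u. _ * u"] cong: if_cong)
  ultimately show ?thesis by simp
qed

lemma tendsto_matrix_inv:
  fixes f :: "'a \<Rightarrow> complex^'n^'n"
  assumes f: "(f \<longlongrightarrow> A) G" and A: "det A \<noteq> 0"
  shows "((\<lambda>x. matrix_inv (f x)) \<longlongrightarrow> matrix_inv A) G"
proof (rule tendsto_matrix)
  fix i k
  have ev: "\<forall>\<^sub>F x in G. det (f x) \<noteq> 0"
    using tendsto_imp_eventually_ne[OF tendsto_det[OF f] A] .
  have nth: "((\<lambda>x. f x $ r $ s) \<longlongrightarrow> A $ r $ s) G" for r s
    by (intro tendsto_vec_nth f)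
  have "((\<lambda>x. det (\<chi> r s. if s = i then axis k 1 $ r else f x $ r $ s) / det (f x)) \<longlongrightarrow>
      det (\<chi> r s. if s = i then axis k 1 $ r else A $ r $ s) / det A) G"
    by (intro tendsto_divide tendsto_det f A tendsto_matrix) (auto intro: nth)
  then show "((\<lambda>x. matrix_inv (f x) $ i $ k) \<longlongrightarrow> matrix_inv A $ i $ k) G"
    unfolding matrix_inv_cramer[OF A]
    by (rule Lim_transform_eventually) (use ev in eventually_elim, simp add: matrix_inv_cramer)
qed

text \<open>The determinant is taken over the polynomial ring; evaluation at \<open>z0\<close> shows
  that this polynomial is nonzero, so it has finitely many roots.\<close>

lemma finite_singular_pencil:
  fixes A B :: "complex^'n^'n"
  assumes "det (\<chi> i j. A $ i $ j + z0 * B $ i $ j) \<noteq> 0"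
  shows "finite {z. det (\<chi> i j. A $ i $ j + z * B $ i $ j) = 0}"
proof -
  define P where "P = det (\<chi> i j. [:A $ i $ j, B $ i $ j:])"
  have P: "poly P z = det (\<chi> i j. A $ i $ j + z * B $ i $ j)" for z
    by (simp add: P_def det_def poly_sum poly_prod)
  then have "P \<noteq> 0" using assms by force
  then show ?thesis using poly_roots_finite[of P] by (simp add: P)
qed

text \<open>Along the complex line of normals, the diffeomorphism type is locally constant on the
  generic parameters \<open>Z\<close>, and \<open>Z\<close> is connected.\<close>

lemma diffeomorphic_generic_normals:
  fixes n n' :: "nat \<Rightarrow> complex^'d"
  assumes "generic_normals m D n" "generic_normals m D n'"
  shows "diffeomorphic (normals_complement m n) (normals_complement m n')"
proof -
  interpret n: generic_normals m D n by fact
  interpret n': generic_normals m D n' by fact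
  define q where "q z i = n i + z *s (n' i - n i)" for z i
  define M where "M z t = frame_matrix D (q z) t" for z t
  define Z where "Z = {z. \<forall>t\<in>frames D m. det (M z t) \<noteq> 0}"
  have q01: "q 0 = n" "q 1 = n'" by (auto simp: q_def)
  have Z01: "0 \<in> Z" "1 \<in> Z"
    using n.det n'.det by (auto simp: Z_def M_def q01)
  have M_nth: "M z t $ i $ j = M 0 t $ i $ j + z * (M 1 t $ i $ j - M 0 t $ i $ j)" for z t i j
    by (auto simp: M_def frame_matrix_def q_def algebra_simps)
  have M_pencil: "M z t = (\<chi> i j. M 0 t $ i $ j + z * (M 1 t - M 0 t) $ i $ j)" for z t
    using M_nth[of z t] by (simp add: vec_eq_iff)
  have "finite {z. det (M z t) = 0}" if "t \<in> frames D m" for t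
    using finite_singular_pencil[of "M 0 t" 0 "M 1 t - M 0 t"] Z01(1) that
    unfolding M_pencil[symmetric] by (simp add: Z_def)
  moreover have "- Z = (\<Union>t\<in>frames D m. {z. det (M z t) = 0})"
    by (auto simp: Z_def)
  ultimately have fin: "finite (- Z)"
    using finite_UN_I[OF finite_frames, of D m "\<lambda>t. {z. det (M z t) = 0}"] by simp
  \<comment> \<open>The plane minus finitely many points is connected; this is where complex
    parameters matter, as a real line would fall apart.\<close>
  have "connected (UNIV - (- Z))"
    by (rule connected_open_delete_finite[OF _ _ _ fin]) auto
  then have conn: "connected Z" by (simp add: Diff_Compl)
  have supp: "supported_on D (q z i)" if "i \<in> {1..m}" for z i
    using n.supp[OF that] n'.supp[OF that] by (simp add: supported_on_def q_def)
  have gen: "generic_normals m D (q z)" if "z \<in> Z" for z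
    using that supp n.m n.cardD by unfold_locales (auto simp: Z_def M_def)
  have q_lim: "((\<lambda>w. q w i) \<longlongrightarrow> q z i) (nhds z)" for z i
    unfolding q_def by (rule vec_tendstoI) (auto intro!: tendsto_intros tendsto_ident_at simp: filterlim_ident)
  have M_lim: "((\<lambda>w. M w t) \<longlongrightarrow> M z t) (nhds z)" for z t
    by (rule tendsto_matrix, subst M_nth, subst (2) M_nth) (intro tendsto_intros filterlim_ident)
  let ?R = "\<lambda>z w. diffeomorphic (normals_complement m (q z)) (normals_complement m (q w))"
  have "?R 0 1"
  proof (rule connected_equivalence_relation[OF conn Z01])
    fix z assume z: "z \<in> Z"
    interpret z: generic_normals m D "q z" using gen[OF z] .
    obtain e where e: "e > 0"
      "\<And>E n'. (\<And>t. t \<in> frames D m \<Longrightarrow> norm (E t) \<le> e) \<Longrightarrow>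
      (\<And>i. i \<in> {1..m} \<Longrightarrow> supported_on D (n' i) \<and> norm (n' i - q z i) \<le> e) \<Longrightarrow>
      (\<And>t. t \<in> frames D m \<Longrightarrow> frame_matrix D n' t ** (mat 1 + E t) = frame_matrix D (q z) t) \<Longrightarrow>
      diffeomorphic (normals_complement m (q z)) (normals_complement m n')"
      using z.diffeomorphic_nearby by blast
    \<comment> \<open>The solution of \<open>M w t ** (mat 1 + E w t) = M z t\<close>; it tends to 0
      as \<open>w\<close> approaches \<open>z\<close>.\<close>
    define E where "E w t = matrix_inv (M w t) ** M z t - mat 1" for w t
    have dz: "det (M z t) \<noteq> 0" if "t \<in> frames D m" for t
      using z that by (simp add: Z_def)
    have E_lim: "((\<lambda>w. E w t) \<longlongrightarrow> 0) (nhds z)" if "t \<in> frames D m" for t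
    proof -
      have "((\<lambda>w. matrix_inv (M w t) ** M z t) \<longlongrightarrow> matrix_inv (M z t) ** M z t) (nhds z)"
        unfolding matrix_matrix_mult_def
        by (rule tendsto_matrix)
          (auto intro!: tendsto_intros tendsto_matrix_inv[OF M_lim dz[OF that]])
      then show ?thesis
        unfolding E_def using dz[OF that]
        by (simp add: matrix_inv_works invertible_det_nz LIM_zero)
    qed
    \<comment> \<open>Finiteness of the frames, and of the indices below, yields a common
      neighbourhood.\<close>
    have ev1: "\<forall>\<^sub>F w in nhds z. \<forall>t\<in>frames D m. norm (E w t) < e"
      using tendstoD[OF E_lim e(1)] by (intro eventually_ball_finite finite_frames ballI) simp
    have ev2: "\<forall>\<^sub>F w in nhds z. \<forall>i\<in>{1..m}. norm (q w i - q z i) < e"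
      using tendstoD[OF q_lim e(1)] by (intro eventually_ball_finite) (auto simp: dist_norm)
    obtain T where T: "open T" "z \<in> T"
      "\<And>w. w \<in> T \<Longrightarrow> (\<forall>t\<in>frames D m. norm (E w t) < e) \<and> (\<forall>i\<in>{1..m}. norm (q w i - q z i) < e)"
      using eventually_conj[OF ev1 ev2] unfolding eventually_nhds by blast
    show "\<exists>T. openin (top_of_set Z) T \<and> z \<in> T \<and> (\<forall>w\<in>T. ?R z w)"
    proof (intro exI[of _ "Z \<inter> T"] conjI ballI)
      fix w assume w: "w \<in> Z \<inter> T"
      show "?R z w"
      proof (rule e(2)[of "E w"])
        fix t assume t: "t \<in> frames D m"
        have "M w t ** matrix_inv (M w t) = mat 1"
          using w t by (simp add: matrix_inv_works invertible_det_nz Z_def)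
        then have "M w t ** (mat 1 + E w t) = M z t"
          by (simp add: E_def matrix_mul_assoc)
        then show "frame_matrix D (q w) t ** (mat 1 + E w t) = frame_matrix D (q z) t"
          by (simp add: M_def)
      qed (use T(3)[of w] w supp in \<open>auto intro: less_imp_le\<close>)
    qed (use T z in auto)
  qed (use diffeomorphic_sym diffeomorphic_trans in blast)+
  then show ?thesis by (simp add: q01)
qed

section \<open>Normal vectors of a uniform arrangement\<close>

lemma vec_dim_le: "vec.dim (S :: ('a::field^'n) set) \<le> CARD('n)"
  using vec.dim_subset_UNIV[of S] by (simp add: vec.dimension_def card_cart_basis)

text \<open>For \<open>v\<close> outside \<open>H\<close>, the projection \<open>f\<close> onto the
  line of \<open>v\<close> along \<open>H\<close> has kernel \<open>H\<close>; a coordinate of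
  \<open>f\<close> in which \<open>v\<close> is nonzero is the required form.\<close>

lemma hyperplane_normal:
  fixes H :: "(complex^'d) set"
  assumes H: "vec.subspace H" "codim H = 1"
  obtains a where "\<And>x. x \<in> H \<longleftrightarrow> scalar_product a x = 0"
proof -
  have "vec.dim H \<noteq> vec.dim (UNIV :: (complex^'d) set)"
    using H(2) by (auto simp: codim_def vec_dim_card card_cart_basis)
  then have "H \<noteq> UNIV" by metis
  then obtain v where v: "v \<notin> H" by blast
  obtain B where B: "B \<subseteq> H" "vec.independent B" "H \<subseteq> vec.span B" "card B = vec.dim H"
    using vec.basis_exists by blast
  have spB: "vec.span B = H"
    using B H(1) vec.span_minimal by blast
  have ind: "vec.independent (insert v B)"
    using B(2) v spB by (simp add: vec.independent_insert)
  have "card (insert v B) = Suc (card B)"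
    using v spB B(1) vec.independent_bound_general[OF B(2)] by (subst card_insert_disjoint) auto
  also have "\<dots> = CARD('d)"
    using H(2) B(4) by (simp add: codim_def)
  finally have card: "vec.dim (UNIV :: (complex^'d) set) \<le> card (insert v B)"
    by (simp add: vec_dim_card card_cart_basis)
  have sp: "vec.span (insert v B) = UNIV"
    using vec.card_ge_dim_independent[OF subset_UNIV ind card] by auto
  obtain f where f: "Vector_Spaces.linear (*s) (*s) f" "\<And>x. x \<in> insert v B \<Longrightarrow> f x = (if x = v then v else 0)"
    using vec.linear_independent_extend[OF ind, of "\<lambda>x. if x = v then v else 0"] by blast
  have fH: "f x = 0" if "x \<in> H" for x
  proof (rule vec.linear_eq_0_on_span[OF f(1)])
    show "x \<in> vec.span B" using that spB by simp
    show "f b = 0" if "b \<in> B" for b using f(2)[of b] that B(1) v by auto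
  qed
  have fv: "f v = v" using f(2) by simp
  have iff: "x \<in> H \<longleftrightarrow> f x = 0" for x
  proof
    assume 0: "f x = 0"
    obtain k where k: "x - k *s v \<in> vec.span B"
      using sp vec.span_breakdown_eq[of x v B] by auto
    then have "f (x - k *s v) = 0" using fH spB by simp
    then have "k *s v = 0"
      using 0 fv by (simp add: vec.linear_diff[OF f(1)] vec.linear_scale[OF f(1)])
    with k have "x - 0 \<in> vec.span B" by metis
    then show "x \<in> H" using spB by simp
  qed (rule fH)
  have "v \<noteq> 0" using v vec.subspace_0[OF H(1)] by auto
  then obtain j where j: "v $ j \<noteq> 0" by (auto simp: vec_eq_iff)
  have "scalar_product (matrix f $ j) x = f x $ j" for x
    unfolding matrix_vector_mult_nth[symmetric] by (simp add: matrix_works[OF f(1)])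
  \<comment> \<open>All values of \<open>f\<close> are multiples of \<open>v\<close>, so the single
    coordinate \<open>j\<close> detects them.\<close>
  moreover have "f x = 0 \<longleftrightarrow> f x $ j = 0" for x
  proof -
    obtain k where k: "x - k *s v \<in> vec.span B"
      using sp vec.span_breakdown_eq[of x v B] by auto
    then have "f (x - k *s v) = 0" using fH spB by simp
    then have "f x = k *s v"
      using fv by (simp add: vec.linear_diff[OF f(1)] vec.linear_scale[OF f(1)])
    then show ?thesis using j by auto
  qed
  ultimately show thesis using iff by (intro that[of "matrix f $ j"]) auto
qed

section \<open>Codimension of intersections\<close>

lemma codim_Int_hyperplane:
  fixes U H :: "(complex^'d) set"
  assumes "vec.subspace U" "vec.subspace H" "codim H = 1"
  shows "codim (U \<inter> H) \<le> codim U + 1"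
proof -
  have "vec.dim {x + y |x y. x \<in> U \<and> y \<in> H} + vec.dim (U \<inter> H) = vec.dim U + vec.dim H"
    by (rule vec.dim_sums_Int[OF assms(1,2)])
  moreover have "vec.dim {x + y |x y. x \<in> U \<and> y \<in> H} \<le> CARD('d)" by (rule vec_dim_le)
  ultimately show ?thesis using assms(3) vec_dim_le[of U] by (simp add: codim_def)
qed

lemma codim_mono: "U \<subseteq> V \<Longrightarrow> codim V \<le> codim U"
  unfolding codim_def by (intro diff_le_mono2 vec.dim_subset)

lemma codim_eq_imp_eq:
  assumes "vec.subspace U" "vec.subspace V" "U \<subseteq> V" "codim U = codim V"
  shows "U = V"
  using assms vec_dim_le[of U] vec_dim_le[of V]
  by (intro vec.subspace_dim_equal) (auto simp: codim_def)

lemma subspace_Inter_arrangement: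
  assumes "central_arrangement m A" "I \<subseteq> {1..m}"
  shows "vec.subspace (\<Inter>i\<in>I. A i)"
  using assms by (intro vec.subspace_Int) (auto simp: central_arrangement_def)

lemma codim_Inter_le_card:
  assumes A: "central_arrangement m A" and I: "I \<subseteq> {1..m}"
  shows "codim (\<Inter>i\<in>I. A i) \<le> card I"
proof -
  have "finite I" using I finite_subset by blast
  then show ?thesis using I
  proof (induction I rule: finite_induct)
    case empty
    then show ?case by (simp add: codim_def vec_dim_card card_cart_basis)
  next
    case (insert i I)
    have "codim ((\<Inter>i\<in>I. A i) \<inter> A i) \<le> codim (\<Inter>i\<in>I. A i) + 1"
      using A insert by (intro codim_Int_hyperplane subspace_Inter_arrangement[OF A])
        (auto simp: central_arrangement_def)
    then show ?case using insert by (simp add: Int_commute)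
  qed
qed

section \<open>Independent normals and adapted coordinates\<close>

lemma scalar_product_transpose:
  "scalar_product (transpose B *v a) y = scalar_product a (B *v (y :: complex^'n))"
proof -
  have "scalar_product (transpose B *v a) y = (\<Sum>i\<in>UNIV. \<Sum>k\<in>UNIV. B $ k $ i * a $ k * y $ i)"
    by (simp add: scalar_product_def matrix_vector_mult_def transpose_def sum_distrib_right)
  also have "\<dots> = (\<Sum>k\<in>UNIV. \<Sum>i\<in>UNIV. B $ k $ i * a $ k * y $ i)"
    by (rule sum.swap)
  also have "\<dots> = scalar_product a (B *v y)"
    by (simp add: scalar_product_def matrix_vector_mult_def sum_distrib_left mult_ac)
  finally show ?thesis .
qed

lemma vec_subspace_annihilator: "vec.subspace {a :: complex^'n. scalar_product a x = 0}"
  unfolding vec.subspace_def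
  by (auto simp: scalar_product_def algebra_simps sum.distrib sum_distrib_left[symmetric])

text \<open>The annihilator of the point \<open>b\<close> is a subspace containing every other
  vector of the family, hence their span, but not \<open>a k\<close>.\<close>

lemma independent_of_dual:
  fixes a :: "'i \<Rightarrow> complex^'n"
  assumes dual: "\<And>k. k \<in> I \<Longrightarrow> \<exists>b. scalar_product (a k) b \<noteq> 0 \<and> (\<forall>i\<in>I - {k}. scalar_product (a i) b = 0)"
  shows "inj_on a I" "vec.independent (a ` I)"
proof -
  show inj: "inj_on a I"
  proof (rule inj_onI)
    fix i k assume "i \<in> I" "k \<in> I" "a i = a k"
    then show "i = k" using dual[of k] by (metis DiffI singletonD)
  qed
  show "vec.independent (a ` I)"
    unfolding vec.dependent_def
  proof safe
    fix k assume k: "k \<in> I" "a k \<in> vec.span (a ` I - {a k})"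
    obtain b where b: "scalar_product (a k) b \<noteq> 0" "\<forall>i\<in>I - {k}. scalar_product (a i) b = 0"
      using dual[OF k(1)] by blast
    have "a ` I - {a k} \<subseteq> {c. scalar_product c b = 0}" using b(2) by auto
    then have "vec.span (a ` I - {a k}) \<subseteq> {c. scalar_product c b = 0}"
      by (intro vec.span_minimal vec_subspace_annihilator)
    then show False using k(2) b(1) by blast
  qed
qed

text \<open>The vectors are completed to a basis and the new ones fill the rows off
  \<open>D\<close>. A vector in the kernel is annihilated by a spanning set and so is zero.\<close>

lemma independent_rows_extend:
  fixes a :: "'d::finite \<Rightarrow> complex^'d"
  assumes "inj_on a D" "vec.independent (a ` D)"
  obtains M :: "complex^'d^'d" where "det M \<noteq> 0" "\<And>j. j \<in> D \<Longrightarrow> M $ j = a j"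
proof -
  define B where "B = vec.extend_basis (a ` D)"
  have B: "a ` D \<subseteq> B" "vec.independent B" "vec.span B = UNIV"
    using vec.extend_basis_superset[OF assms(2)] vec.independent_extend_basis[OF assms(2)]
      vec.span_extend_basis[OF assms(2)] by (auto simp: B_def)
  have finB: "finite B" using vec.independent_bound_general[OF B(2)] by simp
  have "card B = vec.dim (UNIV :: (complex^'d) set)"
    using vec.dim_eq_card[OF _ B(2), of UNIV] B(3) by simp
  then have cardB: "card B = CARD('d)" by (simp add: vec_dim_card card_cart_basis)
  have "card (- D) = card (B - a ` D)"
    using B(1) finB cardB assms(1)
    by (simp add: card_Diff_subset Compl_eq_Diff_UNIV card_image finite_subset[of "a ` D" B])
  then obtain h where h: "bij_betw h (- D) (B - a ` D)"
    using finite_same_card_bij[of "- D" "B - a ` D"] finB by auto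
  define M where "M = (\<chi> j. if j \<in> D then a j else h j)"
  have range: "\<exists>j. M $ j = b" if "b \<in> B" for b
  proof (cases "b \<in> a ` D")
    case True
    then show ?thesis by (auto simp: M_def)
  next
    case False
    then have "b \<in> h ` (- D)" using h that by (simp add: bij_betw_def)
    then obtain j where "j \<notin> D" "b = h j" by blast
    then show ?thesis by (intro exI[of _ j]) (simp add: M_def)
  qed
  have "x = 0" if "M *v x = 0" for x
  proof -
    have "scalar_product (M $ j) x = 0" for j
      using that by (simp flip: matrix_vector_mult_nth)
    then have "B \<subseteq> {c. scalar_product c x = 0}" using range by force
    then have "vec.span B \<subseteq> {c. scalar_product c x = 0}"
      by (intro vec.span_minimal vec_subspace_annihilator)
    then have "scalar_product (axis j 1) x = 0" for j using B(3) by auto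
    then show "x = 0" by (simp add: scalar_product_axis vec_eq_iff)
  qed
  then have "det M \<noteq> 0"
    by (metis invertible_det_nz invertible_left_inverse matrix_left_invertible_ker)
  then show thesis by (intro that[of M]) (auto simp: M_def)
qed

text \<open>The forms of \<open>card D\<close> of the hyperplanes become the coordinates indexed by
  \<open>D\<close>. As the rank is \<open>card D\<close>, every other form vanishes where these do,
  so all transformed normals are supported on \<open>D\<close>.\<close>

lemma normal_form:
  fixes A :: "nat \<Rightarrow> (complex^'d) set" and D :: "'d set"
  assumes A: "central_arrangement m A" and m: "1 \<le> m" and r: "card D \<le> m"
    and ind: "\<And>I. I \<subseteq> {1..m} \<Longrightarrow> codim (\<Inter>i\<in>I. A i) = card I \<longleftrightarrow> card I \<le> card D"
  obtains n where "generic_normals m D n" "diffeomorphic (complement_manifold m A) (normals_complement m n)"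
proof -
  have "\<forall>i\<in>{1..m}. \<exists>a. \<forall>x. x \<in> A i \<longleftrightarrow> scalar_product a x = 0"
    using A hyperplane_normal unfolding central_arrangement_def by metis
  then obtain a where a: "\<And>i x. i \<in> {1..m} \<Longrightarrow> x \<in> A i \<longleftrightarrow> scalar_product (a i) x = 0"
    by metis
  \<comment> \<open>A set of \<open>card D + 1\<close> indices is dependent, so adding
    \<open>k\<close> to \<open>J\<close> cannot raise the codimension, and nested subspaces of equal
    codimension coincide.\<close>
  have flat: "(\<Inter>i\<in>J. A i) \<subseteq> A k" if J: "J \<subseteq> {1..m}" "card J = card D" and k: "k \<in> {1..m}" for J k
  proof (cases "k \<in> J")
    case False
    have fin: "finite J" using J(1) finite_subset by blast
    have kJ: "insert k J \<subseteq> {1..m}" using J(1) k by auto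
    have "codim (\<Inter>i\<in>insert k J. A i) \<noteq> card D + 1"
      using ind[OF kJ] False fin J(2) by simp
    moreover have "codim (\<Inter>i\<in>insert k J. A i) \<le> card D + 1"
      using codim_Inter_le_card[OF A kJ] False fin J(2) by simp
    moreover have "codim (\<Inter>i\<in>J. A i) = card D" using ind[OF J(1)] J(2) by simp
    moreover have "codim (\<Inter>i\<in>J. A i) \<le> codim (\<Inter>i\<in>insert k J. A i)"
      by (intro codim_mono) auto
    ultimately have "(\<Inter>i\<in>insert k J. A i) = (\<Inter>i\<in>J. A i)"
      by (intro codim_eq_imp_eq subspace_Inter_arrangement[OF A] kJ J(1)) auto
    then show ?thesis by blast
  qed auto
  obtain \<sigma> where \<sigma>: "bij_betw \<sigma> D {1..card D}"
    using finite_same_card_bij[of D "{1..card D}"] by auto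
  have \<sigma>m: "\<sigma> j \<in> {1..m}" if "j \<in> D" for j
    using bij_betw_apply[OF \<sigma> that] r by simp
  \<comment> \<open>Otherwise hyperplane \<open>\<sigma> k\<close> would contain the intersection of
    the others, and \<open>card D - 1\<close> hyperplanes would already have an intersection of
    codimension \<open>card D\<close>.\<close>
  have dual: "\<exists>b. scalar_product (a (\<sigma> k)) b \<noteq> 0 \<and> (\<forall>i\<in>D - {k}. scalar_product (a (\<sigma> i)) b = 0)"
    if k: "k \<in> D" for k
  proof (rule ccontr)
    assume no: "\<not> ?thesis"
    let ?J = "\<sigma> ` (D - {k})" and ?I = "\<sigma> ` D"
    have inj: "inj_on \<sigma> D" using \<sigma> by (simp add: bij_betw_def)
    have sub: "?J \<subseteq> {1..m}" "?I \<subseteq> {1..m}" using \<sigma>m by auto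
    have "(\<Inter>i\<in>?J. A i) \<subseteq> A (\<sigma> k)"
    proof
      fix x assume "x \<in> (\<Inter>i\<in>?J. A i)"
      then have "\<forall>i\<in>D - {k}. scalar_product (a (\<sigma> i)) x = 0" using a \<sigma>m by auto
      then have "scalar_product (a (\<sigma> k)) x = 0" using no by blast
      then show "x \<in> A (\<sigma> k)" using a \<sigma>m[OF k] by simp
    qed
    then have "(\<Inter>i\<in>?I. A i) = (\<Inter>i\<in>?J. A i)" using k by auto
    moreover have "codim (\<Inter>i\<in>?I. A i) = card D"
      using ind[OF sub(2)] by (simp add: card_image inj)
    moreover have "codim (\<Inter>i\<in>?J. A i) \<le> card D - 1"
      using codim_Inter_le_card[OF A sub(1)] k inj_on_subset[OF inj, of "D - {k}"]
      by (simp add: card_image)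
    moreover have "card D > 0" using k card_gt_0_iff by fastforce
    ultimately show False by simp
  qed
  obtain M where M: "det M \<noteq> 0" "\<And>j. j \<in> D \<Longrightarrow> M $ j = a (\<sigma> j)"
    using independent_rows_extend[of "\<lambda>j. a (\<sigma> j)" D] independent_of_dual[of D "\<lambda>j. a (\<sigma> j)"] dual
    by blast
  have inv: "matrix_inv M *v (M *v x) = x" "M *v (matrix_inv M *v x) = x" for x
    using M(1) by (simp_all add: matrix_vector_mul_assoc matrix_inv_works invertible_det_nz)
  define n where "n i = transpose (matrix_inv M) *v a i" for i
  have n: "scalar_product (n i) y = scalar_product (a i) (matrix_inv M *v y)" for i y
    unfolding n_def by (rule scalar_product_transpose)
  have nA: "matrix_inv M *v y \<in> A i \<longleftrightarrow> scalar_product (n i) y = 0" if "i \<in> {1..m}" for i y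
    using a[OF that] by (simp add: n)
  have row: "scalar_product (n (\<sigma> j)) y = y $ j" if "j \<in> D" for j y
  proof -
    have "scalar_product (n (\<sigma> j)) y = (M *v (matrix_inv M *v y)) $ j"
      unfolding n M(2)[OF that, symmetric] by (simp add: matrix_vector_mult_nth)
    then show ?thesis by (simp add: inv)
  qed
  have flat_n: "scalar_product (n k) y = 0"
    if J: "J \<subseteq> {1..m}" "card J = card D" and k: "k \<in> {1..m}"
      and 0: "\<And>i. i \<in> J \<Longrightarrow> scalar_product (n i) y = 0" for J k y
  proof -
    have "matrix_inv M *v y \<in> (\<Inter>i\<in>J. A i)" using 0 J(1) nA by blast
    then show ?thesis using flat[OF J k] nA[OF k] by blast
  qed
  have "generic_normals m D n"
  proof
    fix i assume i: "i \<in> {1..m}"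
    have "n i $ j = 0" if "j \<notin> D" for j
    proof -
      \<comment> \<open>The basis vector off \<open>D\<close> lies on all the chosen hyperplanes,
        whose forms are now the coordinates in \<open>D\<close>, hence on every hyperplane.\<close>
      have "scalar_product (n i) (axis j 1) = 0"
      proof (rule flat_n[OF _ _ i])
        show "\<sigma> ` D \<subseteq> {1..m}" using \<sigma>m by auto
        show "card (\<sigma> ` D) = card D" using \<sigma> by (simp add: bij_betw_def)
        show "scalar_product (n k) (axis j 1) = 0" if "k \<in> \<sigma> ` D" for k
          using that row \<open>j \<notin> D\<close> by (auto simp: axis_def)
      qed
      then show ?thesis
        by (simp add: scalar_product_def axis_def if_distrib[of "\<lambda>u. _ * u"] cong: if_cong)
    qed
    then show "supported_on D (n i)" by (simp add: supported_on_def)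
  next
    fix t assume t: "t \<in> frames D m"
    have "x = 0" if x: "frame_matrix D n t *v x = 0" for x
    proof -
      have x_nth: "scalar_product (frame_matrix D n t $ j) x = 0" for j
        using x by (metis matrix_vector_mult_nth zero_index)
      have out: "x $ j = 0" if "j \<notin> D" for j
        using x_nth[of j] that by (simp add: frame_matrix_def scalar_product_axis)
      have zero: "scalar_product (n i) x = 0" if "i \<in> t ` D" for i
      proof -
        obtain j where "j \<in> D" "i = t j" using \<open>i \<in> t ` D\<close> by blast
        then show ?thesis using x_nth[of j] by (simp add: frame_matrix_def)
      qed
      \<comment> \<open>A common zero of the frame's forms is a zero of all forms, in particular of
        the one that is coordinate \<open>j\<close>.\<close>
      have "x $ j = 0" if "j \<in> D" for j
      proof -
        have "scalar_product (n (\<sigma> j)) x = 0"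
        proof (rule flat_n[OF _ _ \<sigma>m[OF that] zero])
          show "t ` D \<subseteq> {1..m}" "card (t ` D) = card D"
            using t by (auto simp: frames_def card_image)
        qed
        then show ?thesis by (simp add: row[OF that])
      qed
      then show "x = 0" using out by (auto simp: vec_eq_iff)
    qed
    then show "det (frame_matrix D n t) \<noteq> 0"
      by (metis invertible_det_nz invertible_left_inverse matrix_left_invertible_ker)
  qed (use m r in auto)
  moreover have "diffeomorphic (complement_manifold m A) (normals_complement m n)"
  proof -
    have "y \<in> normals_complement m n \<longleftrightarrow> matrix_inv M *v y \<in> complement_manifold m A" for y
      using nA by (auto simp: normals_complement_def complement_manifold_def)
    then have mem: "\<And>y. y \<in> normals_complement m n \<Longrightarrow> matrix_inv M *v y \<in> complement_manifold m A"
      "\<And>x. x \<in> complement_manifold m A \<Longrightarrow> M *v x \<in> normals_complement m n"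
      by (simp_all add: inv)
    have im1: "(\<lambda>x. M *v x) ` complement_manifold m A = normals_complement m n"
    proof (intro equalityI image_subsetI subsetI mem)
      fix y assume "y \<in> normals_complement m n"
      then show "y \<in> (\<lambda>x. M *v x) ` complement_manifold m A"
        by (intro image_eqI[of _ _ "matrix_inv M *v y"]) (simp_all add: inv mem)
    qed
    have im2: "(\<lambda>y. matrix_inv M *v y) ` normals_complement m n = complement_manifold m A"
      unfolding im1[symmetric] image_image inv by simp
    have op: "open (complement_manifold m A)" "open (normals_complement m n)"
      using open_complement_manifold[OF A] open_normals_complement by auto
    have "Ck_on k (complement_manifold m A) (\<lambda>x. M *v x)"
      "Ck_on k (normals_complement m n) (\<lambda>y. matrix_inv M *v y)" for k
      by (rule Ck_on_linear[OF op(1) matrix_vector_mult.bounded_linear_right Ck_on_ident[OF op(1)]],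
          rule Ck_on_linear[OF op(2) matrix_vector_mult.bounded_linear_right Ck_on_ident[OF op(2)]])
    then show ?thesis
      unfolding diffeomorphic_def smooth_on_def
      by (intro conjI exI[of _ "\<lambda>x. M *v x"] exI[of _ "\<lambda>y. matrix_inv M *v y"])
        (simp_all add: op im1 im2 inv)
  qed
  ultimately show thesis by (rule that)
qed

theorem corollary5p6:
  fixes m :: nat and A B :: "nat \<Rightarrow> (complex^'d) set"
  assumes "central_arrangement m A"
    and "central_arrangement m B"
    and "underlying_matroid m A = underlying_matroid m B"
    and "uniform_matroid (underlying_matroid m A)"
  shows "diffeomorphic (complement_manifold m A) (complement_manifold m B)"
proof (cases "m = 0")
  case True
  then show ?thesis
    by (simp add: complement_manifold_def diffeomorphic_refl)
next
  case False
  have indep: "matroid_indep (underlying_matroid m A) I \<longleftrightarrow> codim (\<Inter>i\<in>I. A i) = card I"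
    if "I \<subseteq> {1..m}" for I and A :: "nat \<Rightarrow> (complex^'d) set"
    using that finite_subset[OF that] by (simp add: matroid_indep_def underlying_matroid_def)
  obtain r' where r': "\<And>I. I \<subseteq> {1..m} \<Longrightarrow>
      matroid_indep (underlying_matroid m A) I \<longleftrightarrow> finite I \<and> card I \<le> r'"
    using assms(4) by (auto simp: uniform_matroid_def underlying_matroid_def)
  \<comment> \<open>The bound witnessing uniformity may exceed the size of the ground set;
    truncation gives the actual rank without changing which subsets are independent.\<close>
  define r where "r = min r' m"
  have card_le: "card I \<le> m" if "I \<subseteq> {1..m}" for I
    using card_mono[OF _ that] by simp
  have ind: "codim (\<Inter>i\<in>I. A i) = card I \<longleftrightarrow> card I \<le> r"
    "codim (\<Inter>i\<in>I. B i) = card I \<longleftrightarrow> card I \<le> r" if I: "I \<subseteq> {1..m}" for I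
    using indep[OF I, of A] indep[OF I, of B] r'[OF I] card_le[OF I] finite_subset[OF I] assms(3)
    by (simp_all add: r_def)
  have "codim (\<Inter>i\<in>{1..r}. A i) = r"
    using ind(1)[of "{1..r}"] by (simp add: r_def)
  \<comment> \<open>As a codimension, the rank is at most the dimension, so there is a set
    \<open>D\<close> of \<open>r\<close> coordinates, to be shared by both normal forms.\<close>
  then have "r \<le> CARD('d)" by (metis codim_def diff_le_self)
  then obtain D :: "'d set" where D: "card D = r"
    by (metis obtain_subset_with_card_n)
  have "1 \<le> m" "card D \<le> m" using False D by (auto simp: r_def)
  obtain n where n: "generic_normals m D n"
      "diffeomorphic (complement_manifold m A) (normals_complement m n)"
    using normal_form[OF assms(1) \<open>1 \<le> m\<close> \<open>card D \<le> m\<close>] ind(1) D by metis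
  obtain n' where n': "generic_normals m D n'"
      "diffeomorphic (complement_manifold m B) (normals_complement m n')"
    using normal_form[OF assms(2) \<open>1 \<le> m\<close> \<open>card D \<le> m\<close>] ind(2) D by metis
  show ?thesis
    using n(2) diffeomorphic_generic_normals[OF n(1) n'(1)] n'(2)
    by (blast intro: diffeomorphic_trans diffeomorphic_sym)
qed

end
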